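(* If the temporal step size $\tau$ is sufficiently small (i.e. $\tau\le\tau_0$ for some $\tau_0>0$ independent of the spatial mesh), then the numerical solution of the nonlinear compact difference system on the coarse grid is stable. Precisely, there exists a constant $Q=Q(T,\bar\alpha,Q_g,Q_f)>0$ such that every solution $U_H^n$, $0\le n\le N$, of $$c_{0}[\mathcal{A}_{H}\delta_{t}U_{H}]_{i,j}^{1}-\lambda_{1,1}[\Lambda_{H} U_{H}]_{i,j}^{1}=\lambda_{1,1}\mathcal{A}_{H}f([U_{H}]_{i,j}^{1})+[\mathcal{A}_{H}b]_{i,j}^{1},\quad (i,j)\in\omega_{H},$$ $$c_{0}[\mathcal{A}_{H}\delta_{t}U_{H}]_{i,j}^{n}+\sum_{k=1}^{n-1}\tilde{w}_{n-k}[\mathcal{A}_{H}\delta_{t}U_{H}]_{i,j}^{k}-\mathfrak{I}_{\bar{\alpha}}^{n}[\Lambda_{H} U_H]_{i,j}^{n}=\frac{\lambda_{n,n}}{2}\mathcal{A}_{H}f([U_{H}]_{i,j}^{n})+\sum_{k=1}^{n-1}\widetilde{\lambda}_{n,k}\mathcal{A}_{H}f([U_{H}]_{i,j}^{k})+[\mathcal{A}_{H}b]_{i,j}^{n}$$ for $(i,j)\in\omega_H$, $2\le n\le N$, with $[U_H]^0_{i,j}=u_0(x_i,y_j)$ for $(i,j)\in\omega_H$ and $[U_H]^n_{i,j}=0$ for $(i,j)\in\partial\omega_H$, $0\le n\le N$, satisfies $$\|U_{H}^{n}\|_{H}\le Q\left(\|u_0\|_{H}+\|f(u_0)\|_H+\|\bar{u}_0\|_H\right),\qquad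 1\le n\le N.$$
   Context: **Setting.** $\Omega=(l_x,r_x)\times(l_y,r_y)$, $T>0$, $\alpha:[0,T]\to(1,2)$ three times differentiable with $|\alpha'|+|\alpha''|+|\alpha'''|\le Q_\alpha$ and $\alpha'(0)=0$; $f\in C^2(\mathbb R)$ with $|f'|\le Q_f$; $u_0,\bar u_0$ are initial data on $\bar\Omega$ vanishing on $\partial\Omega$ (consistent with the boundary condition). The scheme discretizes the problem ${}^{c}\partial_t^{\alpha(t)}u-\Delta u=f(u)$ in $\Omega\times(0,T]$, $u(\cdot,0)=u_0$, $\partial_tu(\cdot,0)=\bar u_0$, $u=0$ on $\partial\Omega\times[0,T]$, where ${}^{c}\partial_t^{\alpha(t)}u(\cdot,t)=\int_0^tk(t-s)\partial_s^2u(\cdot,s)ds$, $k(t)=t^{1-\alpha(t)}/\Gamma(2-\alpha(t))$. Put $\alpha_0=\alpha(0)$, $\bar\alpha=\alpha_0-1\in(0,1)$, $\beta_\mu(t)=t^{\mu-1}/\Gamma(\mu)$ and $g(t)=(\beta_{\alpha_0-1}*k)(t)=\int_0^t\frac{(t-s)^{\alpha_0-2}}{\Gamma(\alpha_0-1)}\frac{s^{1-\alpha(s)}}{\Gamma(2-\alpha(s))}ds$, with $g(0)=1$. $Q_g$ denotes a constant with $|g|\le Q_g$, $|g'|\le Q_g$ on $[0,T]$ and $|g''(t)|\le Q_g(|\ln t|+1)$ on $(0,T]$. **Coarse grid.** $H_x=(r_x-l_x)/M_{H,x}$, $H_y=(r_y-l_y)/M_{H,y}$ with positive integers $M_{H,x},M_{H,y}$;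 $x_i=l_x+iH_x$, $y_j=l_y+jH_y$; $\omega_H=\{(i,j):1\le i\le M_{H,x}-1,\,1\le j\le M_{H,y}-1\}$, $\bar\omega_H=\{(i,j):0\le i\le M_{H,x},\,0\le j\le M_{H,y}\}$, $\partial\omega_H=\bar\omega_H\setminus\omega_H$. $\mathcal A_{H,x}v_{i,j}=\frac{v_{i-1,j}+10v_{i,j}+v_{i+1,j}}{12}$ for $1\le i\le M_{H,x}-1$ and $=v_{i,j}$ for $i\in\{0,M_{H,x}\}$; $\mathcal A_{H,y}$ analogously in $j$; $\mathcal A_H=\mathcal A_{H,x}\mathcal A_{H,y}$; $\delta^2_{H,x}v_{i,j}=\frac{v_{i+1,j}-2v_{i,j}+v_{i-1,j}}{H_x^2}$, $\delta^2_{H,y}$ analogously; $\Lambda_H=\mathcal A_{H,y}\delta^2_{H,x}+\mathcal A_{H,x}\delta^2_{H,y}$. $\|v\|_H=\big(H_xH_y\sum_{(i,j)\in\omega_H}v_{i,j}^2\big)^{1/2}$; for a function on $\bar\Omega$ it is applied to its nodal values. **Time discretization.** $\tau=T/N$, $t_n=n\tau$; $v^{n-\frac12}=\frac12(v^n+v^{n-1})$, $\delta_tv^n=(v^n-v^{n-1})/\tau$. $w_k=g(t_{k+1})-g(t_k)$, $\tilde w_k=\frac12(w_k+w_{k-1})$ for $k\ge1$, $c_0=1+\frac{w_0}2$. $\lambda_{n,j}=\frac1\tau\int_{t_{n-1}}^{t_n}\int_{t_{j-1}}^{\min\{t,t_j\}}\beta_{\bar\alpha}(t-s)\,ds\,dt$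 for $1\le j\le n$; $\mathfrak I^n_{\bar\alpha}v^n=\lambda_{n,1}v^1+\sum_{j=2}^n\lambda_{n,j}v^{j-\frac12}$; $\widetilde\lambda_{n,1}=\lambda_{n,1}+\frac{\lambda_{n,2}}2$, $\widetilde\lambda_{n,k}=\frac12(\lambda_{n,k+1}+\lambda_{n,k})$ for $2\le k\le n-1$. $b^n_{i,j}=\frac1\tau\int_{t_{n-1}}^{t_n}g(t)\,\bar u_0(x_i,y_j)\,dt$. *)

theory Defs
  imports "HOL-Analysis.Analysis"
begin

section \<open>The continuous data\<close>

definition variable_order :: "real \<Rightarrow> real \<Rightarrow> (real \<Rightarrow> real) \<Rightarrow> bool" where
  "variable_order T Q\<^sub>\<alpha> \<alpha> \<longleftrightarrow>
     (\<forall>t\<in>{0..T}. 1 < \<alpha> t \<and> \<alpha> t < 2) \<and>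
     (\<exists>\<alpha>1 \<alpha>2 \<alpha>3.
        (\<forall>t\<in>{0..T}.
           (\<alpha> has_real_derivative \<alpha>1 t) (at t within {0..T}) \<and>
           (\<alpha>1 has_real_derivative \<alpha>2 t) (at t within {0..T}) \<and>
           (\<alpha>2 has_real_derivative \<alpha>3 t) (at t within {0..T}) \<and>
           \<bar>\<alpha>1 t\<bar> + \<bar>\<alpha>2 t\<bar> + \<bar>\<alpha>3 t\<bar> \<le> Q\<^sub>\<alpha>) \<and>
        \<alpha>1 0 = 0)"

definition C2_bounded_deriv :: "real \<Rightarrow> (real \<Rightarrow> real) \<Rightarrow> bool" where
  "C2_bounded_deriv Q\<^sub>f f \<longleftrightarrow>
     (\<exists>f1 f2. (\<forall>x. (f has_real_derivative f1 x) (at x)) \<and>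
              (\<forall>x. (f1 has_real_derivative f2 x) (at x)) \<and>
              continuous_on UNIV f2 \<and>
              (\<forall>x. \<bar>f1 x\<bar> \<le> Q\<^sub>f))"

definition rect :: "real \<Rightarrow> real \<Rightarrow> real \<Rightarrow> real \<Rightarrow> (real \<times> real) set" where
  "rect lx rx ly ry = {lx<..<rx} \<times> {ly<..<ry}"

definition beta_kernel :: "real \<Rightarrow> real \<Rightarrow> real" where
  "beta_kernel \<mu> t = t powr (\<mu> - 1) / Gamma \<mu>"

definition k_kernel :: "(real \<Rightarrow> real) \<Rightarrow> real \<Rightarrow> real" where
  "k_kernel \<alpha> t = t powr (1 - \<alpha> t) / Gamma (2 - \<alpha> t)"

text \<open>The value at \<open>0\<close> is the limit of the convolution for \<open>t \<rightarrow> 0+\<close>, not the (zero)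
  integral over a point.\<close>

definition g_fun :: "(real \<Rightarrow> real) \<Rightarrow> real \<Rightarrow> real" where
  "g_fun \<alpha> t =
     (if t = 0 then 1
      else integral {0..t} (\<lambda>s. beta_kernel (\<alpha> 0 - 1) (t - s) * k_kernel \<alpha> s))"

definition g_bounds :: "real \<Rightarrow> real \<Rightarrow> (real \<Rightarrow> real) \<Rightarrow> bool" where
  "g_bounds T Q\<^sub>g g \<longleftrightarrow>
     (\<exists>g1 g2.
        (\<forall>t\<in>{0..T}. (g has_real_derivative g1 t) (at t within {0..T}) \<and>
                    \<bar>g t\<bar> \<le> Q\<^sub>g \<and> \<bar>g1 t\<bar> \<le> Q\<^sub>g) \<and>
        (\<forall>t\<in>{0<..T}. (g1 has_real_derivative g2 t) (at t within {0..T}) \<and>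
                     \<bar>g2 t\<bar> \<le> Q\<^sub>g * (\<bar>ln t\<bar> + 1)))"

section \<open>Spatial grid\<close>

text \<open>A grid function is a map \<open>v i j\<close>, of which only the values with \<open>i \<le> Mx\<close> and
  \<open>j \<le> My\<close> matter.\<close>

type_synonym gridfun = "nat \<Rightarrow> nat \<Rightarrow> real"

definition mesh_size :: "real \<Rightarrow> real \<Rightarrow> nat \<Rightarrow> real" where
  "mesh_size l r M = (r - l) / real M"

definition node :: "real \<Rightarrow> real \<Rightarrow> nat \<Rightarrow> nat \<Rightarrow> real" where
  "node l r M i = l + real i * mesh_size l r M"

definition interior_idx :: "nat \<Rightarrow> nat \<Rightarrow> (nat \<times> nat) set" where
  "interior_idx Mx My = {1..Mx - 1} \<times> {1..My - 1}"

definition all_idx :: "nat \<Rightarrow> nat \<Rightarrow> (nat \<times> nat) set" where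
  "all_idx Mx My = {0..Mx} \<times> {0..My}"

definition boundary_idx :: "nat \<Rightarrow> nat \<Rightarrow> (nat \<times> nat) set" where
  "boundary_idx Mx My = all_idx Mx My - interior_idx Mx My"

definition avg_x :: "nat \<Rightarrow> gridfun \<Rightarrow> gridfun" where
  "avg_x Mx v i j =
     (if 1 \<le> i \<and> i \<le> Mx - 1 then (v (i - 1) j + 10 * v i j + v (i + 1) j) / 12 else v i j)"

definition avg_y :: "nat \<Rightarrow> gridfun \<Rightarrow> gridfun" where
  "avg_y My v i j =
     (if 1 \<le> j \<and> j \<le> My - 1 then (v i (j - 1) + 10 * v i j + v i (j + 1)) / 12 else v i j)"

definition avg :: "nat \<Rightarrow> nat \<Rightarrow> gridfun \<Rightarrow> gridfun" where
  "avg Mx My v = avg_x Mx (avg_y My v)"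

text \<open>The second differences are only used at indices \<open>i \<ge> 1\<close>, respectively \<open>j \<ge> 1\<close>.\<close>

definition diff2_x :: "real \<Rightarrow> gridfun \<Rightarrow> gridfun" where
  "diff2_x hx v i j = (v (i + 1) j - 2 * v i j + v (i - 1) j) / hx\<^sup>2"

definition diff2_y :: "real \<Rightarrow> gridfun \<Rightarrow> gridfun" where
  "diff2_y hy v i j = (v i (j + 1) - 2 * v i j + v i (j - 1)) / hy\<^sup>2"

definition compact_laplace :: "real \<Rightarrow> real \<Rightarrow> nat \<Rightarrow> nat \<Rightarrow> gridfun \<Rightarrow> gridfun" where
  "compact_laplace hx hy Mx My v i j =
     avg_y My (diff2_x hx v) i j + avg_x Mx (diff2_y hy v) i j"

definition grid_norm :: "real \<Rightarrow> real \<Rightarrow> nat \<Rightarrow> nat \<Rightarrow> gridfun \<Rightarrow> real" where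
  "grid_norm hx hy Mx My v = sqrt (hx * hy * (\<Sum>(i, j)\<in>interior_idx Mx My. (v i j)\<^sup>2))"

section \<open>Time discretization\<close>

definition tnode :: "real \<Rightarrow> nat \<Rightarrow> real" where
  "tnode \<tau> n = real n * \<tau>"

definition half_avg :: "(nat \<Rightarrow> real) \<Rightarrow> nat \<Rightarrow> real" where
  "half_avg v n = (v n + v (n - 1)) / 2"

definition tdiff :: "real \<Rightarrow> (nat \<Rightarrow> gridfun) \<Rightarrow> nat \<Rightarrow> gridfun" where
  "tdiff \<tau> V n i j = (V n i j - V (n - 1) i j) / \<tau>"

definition w_coeff :: "real \<Rightarrow> (real \<Rightarrow> real) \<Rightarrow> nat \<Rightarrow> real" where
  "w_coeff \<tau> g k = g (tnode \<tau> (k + 1)) - g (tnode \<tau> k)"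

definition w_avg :: "real \<Rightarrow> (real \<Rightarrow> real) \<Rightarrow> nat \<Rightarrow> real" where
  "w_avg \<tau> g k = (w_coeff \<tau> g k + w_coeff \<tau> g (k - 1)) / 2"

definition c0_coeff :: "real \<Rightarrow> (real \<Rightarrow> real) \<Rightarrow> real" where
  "c0_coeff \<tau> g = 1 + w_coeff \<tau> g 0 / 2"

definition quad_wt :: "real \<Rightarrow> real \<Rightarrow> nat \<Rightarrow> nat \<Rightarrow> real" where
  "quad_wt abar \<tau> n j =
     1 / \<tau> * integral {tnode \<tau> (n - 1)..tnode \<tau> n}
       (\<lambda>t. integral {tnode \<tau> (j - 1)..min t (tnode \<tau> j)} (\<lambda>s. beta_kernel abar (t - s)))"

definition frac_quad :: "real \<Rightarrow> real \<Rightarrow> nat \<Rightarrow> (nat \<Rightarrow> real) \<Rightarrow> real" where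
  "frac_quad abar \<tau> n v =
     quad_wt abar \<tau> n 1 * v 1 + (\<Sum>j = 2..n. quad_wt abar \<tau> n j * half_avg v j)"

definition quad_wt_avg :: "real \<Rightarrow> real \<Rightarrow> nat \<Rightarrow> nat \<Rightarrow> real" where
  "quad_wt_avg abar \<tau> n k =
     (if k = 1 then quad_wt abar \<tau> n 1 + quad_wt abar \<tau> n 2 / 2
      else (quad_wt abar \<tau> n (k + 1) + quad_wt abar \<tau> n k) / 2)"

definition b_term :: "real \<Rightarrow> (real \<Rightarrow> real) \<Rightarrow> gridfun \<Rightarrow> nat \<Rightarrow> gridfun" where
  "b_term \<tau> g v n i j = 1 / \<tau> * integral {tnode \<tau> (n - 1)..tnode \<tau> n} (\<lambda>t. g t * v i j)"

section \<open>The nonlinear compact difference system\<close>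

definition grid_eval ::
  "real \<Rightarrow> real \<Rightarrow> real \<Rightarrow> real \<Rightarrow> nat \<Rightarrow> nat \<Rightarrow> (real \<times> real \<Rightarrow> real) \<Rightarrow> gridfun" where
  "grid_eval lx rx ly ry Mx My u i j = u (node lx rx Mx i, node ly ry My j)"

definition scheme_solution ::
  "real \<Rightarrow> real \<Rightarrow> real \<Rightarrow> real \<Rightarrow> real \<Rightarrow> (real \<Rightarrow> real) \<Rightarrow> (real \<Rightarrow> real) \<Rightarrow>
   (real \<times> real \<Rightarrow> real) \<Rightarrow> (real \<times> real \<Rightarrow> real) \<Rightarrow> nat \<Rightarrow> nat \<Rightarrow> nat \<Rightarrow>
   (nat \<Rightarrow> gridfun) \<Rightarrow> bool" where
  "scheme_solution lx rx ly ry T \<alpha> f u0 ubar0 Mx My N U \<longleftrightarrow>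
    (let \<tau> = T / real N;
         g = g_fun \<alpha>;
         abar = \<alpha> 0 - 1;
         A = avg Mx My;
         L = compact_laplace (mesh_size lx rx Mx) (mesh_size ly ry My) Mx My;
         b = b_term \<tau> g (grid_eval lx rx ly ry Mx My ubar0);
         F = (\<lambda>n i j. f (U n i j))
     in
      (\<forall>(i, j)\<in>interior_idx Mx My.
         c0_coeff \<tau> g * A (tdiff \<tau> U 1) i j - quad_wt abar \<tau> 1 1 * L (U 1) i j
         = quad_wt abar \<tau> 1 1 * A (F 1) i j + A (b 1) i j) \<and>
      (\<forall>n\<in>{2..N}. \<forall>(i, j)\<in>interior_idx Mx My.
         c0_coeff \<tau> g * A (tdiff \<tau> U n) i j
         + (\<Sum>k = 1..n - 1. w_avg \<tau> g (n - k) * A (tdiff \<tau> U k) i j)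
         - frac_quad abar \<tau> n (\<lambda>m. L (U m) i j)
         = quad_wt abar \<tau> n n / 2 * A (F n) i j
         + (\<Sum>k = 1..n - 1. quad_wt_avg abar \<tau> n k * A (F k) i j)
         + A (b n) i j) \<and>
      (\<forall>(i, j)\<in>interior_idx Mx My. U 0 i j = grid_eval lx rx ly ry Mx My u0 i j) \<and>
      (\<forall>n\<in>{0..N}. \<forall>(i, j)\<in>boundary_idx Mx My. U n i j = 0))"

end

theory Submission
  imports Defs
begin

text \<open>
  The proof is an energy argument in time. The \<open>n\<close>-th equation of the scheme is tested with
  \<open>V n\<close>, where \<open>V 1 = U 1\<close> and \<open>V n = (U n + U (n - 1)) / 2\<close> for \<open>n \<ge> 2\<close>: these are the grid
  functions whose discrete Laplacians the fractional quadrature combines. Each term of the scheme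
  then has its own mechanism.

  \<^item> The leading term telescopes in the energy \<open>e n = (A U n, U n)\<close>. The compact average \<open>A\<close> is
    symmetric and its form lies between a third of the squared norm and the squared norm, so \<open>e\<close> is
    equivalent to the squared norm (\<open>avg_form_ge\<close>, \<open>avg_form_le\<close>).

  \<^item> The quadrature weights depend only on \<open>n - j\<close> and are second differences of a convex power.
    With the diagonal doubled they form a nonnegative, nonincreasing, convex sequence, and a Toeplitz
    matrix built from such a sequence is positive semidefinite. The negative compact Laplacian
    is a sum of squares, so the fractional diffusion term has a nonnegative sum over \<open>n\<close> and can
    be dropped (\<open>quad_wt_psd\<close>, \<open>compact_laplace_psd\<close>).

  \<^item> The memory term contains difference quotients, which no energy bound controls. Summation by
    parts moves the difference onto the weights. Their total variation is \<open>O(\<tau>)\<close>, because \<open>g'\<close> is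
    bounded and \<open>g''\<close> is integrable despite its logarithmic singularity at \<open>0\<close>
    (\<open>memory_term_bound\<close>).

  \<^item> In the source term \<open>f (U k)\<close> is split into the constant \<open>f 0\<close>, which \<open>A\<close> preserves, and a rest
    that vanishes on the boundary and is Lipschitz in \<open>U k\<close>. The constant is bounded by
    \<open>f (u0)\<close> and \<open>u0\<close> on the interior nodes. The source weights have bounded row sums.

  Only row sums of the weights occur, because all energies up to level \<open>n\<close> are replaced by their
  running maximum. The maximum satisfies a discrete Gronwall inequality, which closes when \<open>\<tau>\<close> is
  small (\<open>memory_energy_bound\<close>).
\<close>

section \<open>Finite differences of powers\<close>

primrec fdiff :: "nat \<Rightarrow> (real \<Rightarrow> real) \<Rightarrow> real \<Rightarrow> real" where
  "fdiff 0 f x = f x"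
| "fdiff (Suc k) f x = fdiff k f (x + 1) - fdiff k f x"

lemma fdiff_powr_has_derivative:
  assumes "y > 0"
  shows "(fdiff k (\<lambda>x. x powr e) has_real_derivative e * fdiff k (\<lambda>x. x powr (e - 1)) y) (at y)"
  using assms
proof (induction k arbitrary: y)
  case 0
  then show ?case by (auto intro!: derivative_eq_intros simp: fun_eq_iff)
next
  case (Suc k)
  have "((\<lambda>x. fdiff k (\<lambda>x. x powr e) (x + 1)) has_real_derivative
      e * fdiff k (\<lambda>x. x powr (e - 1)) (y + 1)) (at y)"
    using Suc.IH[of "y + 1"] Suc.prems by (simp add: DERIV_shift)
  from DERIV_diff[OF this Suc.IH[OF Suc.prems]] show ?case
    by (simp add: algebra_simps)
qed

lemma fdiff_powr_continuous:
  assumes "0 < x \<or> 0 < e \<and> 0 \<le> x"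
  shows "continuous_on {x..} (fdiff k (\<lambda>x. x powr e))"
  using assms
proof (induction k arbitrary: x)
  case 0
  have "continuous_on {x..} (\<lambda>y. y powr e)"
    by (rule continuous_on_powr') (use 0 in \<open>auto intro: continuous_intros\<close>)
  then show ?case by (simp add: fun_eq_iff cong: continuous_on_cong)
next
  case (Suc k)
  have "continuous_on {x..} (\<lambda>y. fdiff k (\<lambda>x. x powr e) (y + 1))"
    by (rule continuous_on_compose2[OF Suc.IH[of "x + 1"]]) (use Suc.prems in \<open>auto intro!: continuous_intros\<close>)
  then show ?case using Suc.IH[OF Suc.prems] by (auto intro!: continuous_intros)
qed

text \<open>One factor of the falling product is gained per application of the mean value theorem, since
  differences commute with the derivative. The case \<open>x = 0\<close> with \<open>e > 0\<close> is what allows the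
  difference stencil of the quadrature weights to start at the origin, where only continuity is
  available.\<close>

lemma fdiff_powr_mean_value:
  assumes "0 < x \<or> 0 < e \<and> 0 \<le> x"
  shows "\<exists>\<xi>\<in>{x..x + real k}.
           fdiff k (\<lambda>x. x powr e) x = (\<Prod>i<k. e - real i) * \<xi> powr (e - real k)"
  using assms
proof (induction k arbitrary: x e)
  case 0
  then show ?case by auto
next
  case (Suc k)
  have "continuous_on {x..x + 1} (fdiff k (\<lambda>x. x powr e))"
    by (rule continuous_on_subset[OF fdiff_powr_continuous[OF Suc.prems]]) auto
  moreover have "fdiff k (\<lambda>x. x powr e) differentiable (at y)" if "x < y" for y
    using fdiff_powr_has_derivative[of y k e] that Suc.prems
    by (auto simp: real_differentiable_def)
  ultimately obtain l z where z: "x < z" "z < x + 1"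
      and l: "(fdiff k (\<lambda>x. x powr e) has_real_derivative l) (at z)"
      and eq: "fdiff k (\<lambda>x. x powr e) (x + 1) - fdiff k (\<lambda>x. x powr e) x = (x + 1 - x) * l"
    using MVT[of x "x + 1" "fdiff k (\<lambda>x. x powr e)"] by (metis less_add_one)
  have z0: "z > 0" using z Suc.prems by auto
  have "l = e * fdiff k (\<lambda>x. x powr (e - 1)) z"
    using DERIV_unique[OF l fdiff_powr_has_derivative[OF z0]] .
  moreover obtain \<xi> where "\<xi> \<in> {z..z + real k}"
      "fdiff k (\<lambda>x. x powr (e - 1)) z = (\<Prod>i<k. e - 1 - real i) * \<xi> powr (e - 1 - real k)"
    using Suc.IH[of z "e - 1"] z0 by blast
  moreover have "(\<Prod>i<Suc k. e - real i) = e * (\<Prod>i<k. e - 1 - real i)"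
    by (subst prod.lessThan_Suc_shift) (simp add: algebra_simps)
  ultimately show ?case using eq z
    by (intro bexI[of _ \<xi>]) (auto simp del: prod.lessThan_Suc simp add: algebra_simps)
qed

section \<open>Causal convolutions with convex weights\<close>

text \<open>The triangular kernel \<open>(k - \<bar>i - j\<bar>)\<^sup>+\<close> counts the windows of length \<open>k\<close> that contain both
  points, which is what makes it positive semidefinite. For natural numbers \<open>max i j - min i j\<close> is
  the distance, and truncated subtraction is the positive part.\<close>

lemma window_count:
  fixes i j k K :: nat
  assumes "i < K" "j < K"
  shows "card {l \<in> {..<K + k}. (i \<le> l \<and> l < i + k) \<and> (j \<le> l \<and> l < j + k)}
    = k - (max i j - min i j)"
proof -
  have "{l \<in> {..<K + k}. (i \<le> l \<and> l < i + k) \<and> (j \<le> l \<and> l < j + k)} = {max i j..<min i j + k}"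
    using assms by auto
  then show ?thesis by simp
qed

lemma sum_rotate3:
  "(\<Sum>i\<in>A. \<Sum>j\<in>B. \<Sum>l\<in>C. h i j l) = (\<Sum>l\<in>C. \<Sum>i\<in>A. \<Sum>j\<in>B. h i j l)"
  by (simp only: sum.swap[of _ C])

text \<open>The quadratic form is the sum, over all windows of length \<open>k\<close>, of the squared sum of \<open>x\<close>
  over the window.\<close>

lemma triangle_kernel_psd:
  fixes x :: "nat \<Rightarrow> real"
  shows "0 \<le> (\<Sum>i<K. \<Sum>j<K. real (k - (max i j - min i j)) * (x i * x j))"
proof -
  let ?c = "\<lambda>l i. if i \<le> l \<and> l < i + k then x i else 0"
  have "(\<Sum>i<K. \<Sum>j<K. real (k - (max i j - min i j)) * (x i * x j))
      = (\<Sum>i<K. \<Sum>j<K. \<Sum>l<K + k. ?c l i * ?c l j)"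
  proof (intro sum.cong refl)
    fix i j assume ij: "i \<in> {..<K}" "j \<in> {..<K}"
    have "(\<Sum>l<K + k. ?c l i * ?c l j)
        = (\<Sum>l<K + k. if (i \<le> l \<and> l < i + k) \<and> (j \<le> l \<and> l < j + k) then x i * x j else 0)"
      by (intro sum.cong) auto
    also have "\<dots> = real (card {l \<in> {..<K + k}. (i \<le> l \<and> l < i + k) \<and> (j \<le> l \<and> l < j + k)}) * (x i * x j)"
      by (subst sum.inter_filter[symmetric]) auto
    finally show "real (k - (max i j - min i j)) * (x i * x j) = (\<Sum>l<K + k. ?c l i * ?c l j)"
      using window_count[of i K j k] ij by simp
  qed
  also have "\<dots> = (\<Sum>l<K + k. \<Sum>i<K. \<Sum>j<K. ?c l i * ?c l j)"
    by (rule sum_rotate3)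
  also have "\<dots> = (\<Sum>l<K + k. (\<Sum>i<K. ?c l i) * (\<Sum>j<K. ?c l j))"
    by (simp only: sum_product)
  also have "\<dots> \<ge> 0" by (intro sum_nonneg zero_le_square)
  finally show ?thesis .
qed

text \<open>A discrete Taylor expansion from the right end \<open>K\<close>: the coefficients of the triangular kernels
  are the second differences of \<open>R\<close>, which are nonnegative for a convex sequence.\<close>

lemma convex_sequence_triangles:
  fixes R :: "nat \<Rightarrow> real"
  assumes "d \<le> K"
  shows "R d = R K + real (K - d) * (R K - R (Suc K))
     + (\<Sum>k<K. real (Suc k - d) * (R k - 2 * R (Suc k) + R (Suc (Suc k))))"
  using assms
proof (induction K)
  case 0
  then show ?case by simp
next
  case (Suc K)
  show ?case
  proof (cases "d = Suc K")
    case True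
    have "(\<Sum>k<Suc K. real (Suc k - d) * (R k - 2 * R (Suc k) + R (Suc (Suc k)))) = 0"
      using True by (intro sum.neutral) auto
    then show ?thesis using True by simp
  next
    case False
    then have "d \<le> K" using Suc.prems by simp
    then show ?thesis using Suc.IH by (simp add: Suc_diff_le algebra_simps)
  qed
qed

text \<open>A nonnegative, nonincreasing, convex sequence is a nonnegative combination of a constant and of
  triangular kernels.\<close>

lemma convex_toeplitz_psd:
  fixes R x :: "nat \<Rightarrow> real"
  assumes nonneg: "\<And>k. 0 \<le> R k" and decr: "\<And>k. R (Suc k) \<le> R k"
    and convex: "\<And>k. 0 \<le> R k - 2 * R (Suc k) + R (Suc (Suc k))"
  shows "0 \<le> (\<Sum>i<K. \<Sum>j<K. R (max i j - min i j) * (x i * x j))"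
proof -
  let ?d = "\<lambda>i j. max i j - min i j :: nat"
  let ?t = "\<lambda>k. \<Sum>i<K. \<Sum>j<K. real (k - ?d i j) * (x i * x j)"
  let ?c = "\<lambda>k. R k - 2 * R (Suc k) + R (Suc (Suc k))"
  have "(\<Sum>i<K. \<Sum>j<K. R (?d i j) * (x i * x j))
      = (\<Sum>i<K. \<Sum>j<K. R K * (x i * x j) + (R K - R (Suc K)) * (real (K - ?d i j) * (x i * x j))
           + (\<Sum>k<K. ?c k * (real (Suc k - ?d i j) * (x i * x j))))"
  proof (intro sum.cong refl)
    fix i j assume "i \<in> {..<K}" "j \<in> {..<K}"
    then have "?d i j \<le> K" by auto
    have "R (?d i j) * (x i * x j) = (R K + real (K - ?d i j) * (R K - R (Suc K))
        + (\<Sum>k<K. real (Suc k - ?d i j) * ?c k)) * (x i * x j)"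
      by (subst convex_sequence_triangles[OF \<open>?d i j \<le> K\<close>, of R]) (rule refl)
    also have "\<dots> = R K * (x i * x j)
        + (R K - R (Suc K)) * (real (K - ?d i j) * (x i * x j))
        + (\<Sum>k<K. real (Suc k - ?d i j) * ?c k) * (x i * x j)"
      by (simp add: algebra_simps)
    also have "(\<Sum>k<K. real (Suc k - ?d i j) * ?c k) * (x i * x j)
        = (\<Sum>k<K. ?c k * (real (Suc k - ?d i j) * (x i * x j)))"
      by (simp add: sum_distrib_right sum_distrib_left mult_ac)
    finally
    show "R (?d i j) * (x i * x j) = R K * (x i * x j)
        + (R K - R (Suc K)) * (real (K - ?d i j) * (x i * x j))
        + (\<Sum>k<K. ?c k * (real (Suc k - ?d i j) * (x i * x j)))" .
  qed
  also have "\<dots> = R K * (\<Sum>i<K. \<Sum>j<K. x i * x j) + (R K - R (Suc K)) * ?t K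
      + (\<Sum>i<K. \<Sum>j<K. \<Sum>k<K. ?c k * (real (Suc k - ?d i j) * (x i * x j)))"
    by (simp only: sum.distrib sum_distrib_left)
  also have "(\<Sum>i<K. \<Sum>j<K. \<Sum>k<K. ?c k * (real (Suc k - ?d i j) * (x i * x j)))
      = (\<Sum>k<K. \<Sum>i<K. \<Sum>j<K. ?c k * (real (Suc k - ?d i j) * (x i * x j)))"
    by (rule sum_rotate3)
  also have "\<dots> = (\<Sum>k<K. ?c k * ?t (Suc k))"
    by (simp only: sum_distrib_left)
  finally have eq: "(\<Sum>i<K. \<Sum>j<K. R (?d i j) * (x i * x j))
      = R K * (\<Sum>i<K. \<Sum>j<K. x i * x j) + (R K - R (Suc K)) * ?t K + (\<Sum>k<K. ?c k * ?t (Suc k))" .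
  have "0 \<le> (\<Sum>i<K. \<Sum>j<K. x i * x j)"
    by (simp only: sum_product[symmetric]) simp
  then show ?thesis
    unfolding eq using nonneg[of K] decr[of K]
    by (intro add_nonneg_nonneg mult_nonneg_nonneg[OF _ triangle_kernel_psd]
        mult_nonneg_nonneg[of "R K"] sum_nonneg[of "{..<K}" "\<lambda>k. ?c k * ?t (Suc k)"] convex) simp_all
qed

lemma sum_square_split:
  fixes G :: "nat \<Rightarrow> nat \<Rightarrow> real"
  shows "(\<Sum>i<K. \<Sum>j<K. G i j) = (\<Sum>i<K. G i i) + (\<Sum>i<K. \<Sum>j<i. G i j + G j i)"
proof (induction K)
  case 0
  then show ?case by simp
next
  case (Suc K)
  have "(\<Sum>i<Suc K. \<Sum>j<Suc K. G i j)
      = (\<Sum>i<K. \<Sum>j<K. G i j) + (\<Sum>i<K. G i K) + (\<Sum>j<K. G K j) + G K K"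
    by (simp add: sum.distrib)
  then show ?case using Suc by (simp add: sum.distrib)
qed

text \<open>Symmetrizing the causal sum doubles the diagonal weight relative to the others, so the
  convex sequence in question is \<open>2 * r 0, r 1, r 2, \<dots>\<close>, and the conditions at the first two places
  take a special form.\<close>

lemma causal_convex_psd:
  fixes r x :: "nat \<Rightarrow> real"
  assumes nonneg: "\<And>k. 0 \<le> r k" and decr: "\<And>k. 1 \<le> k \<Longrightarrow> r (Suc k) \<le> r k"
    and decr0: "r 1 \<le> 2 * r 0"
    and convex: "\<And>k. 1 \<le> k \<Longrightarrow> 0 \<le> r k - 2 * r (Suc k) + r (Suc (Suc k))"
    and convex0: "0 \<le> 2 * r 0 - 2 * r 1 + r 2"
  shows "0 \<le> (\<Sum>n=1..m. \<Sum>j=1..n. r (n - j) * (x j * x n))"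
proof -
  let ?R = "\<lambda>k. if k = 0 then 2 * r 0 else r k"
  let ?y = "\<lambda>i. x (Suc i)"
  have "0 \<le> (\<Sum>i<m. \<Sum>j<m. ?R (max i j - min i j) * (?y i * ?y j))"
    by (rule convex_toeplitz_psd)
       (use nonneg decr decr0 convex convex0 in \<open>auto simp: numeral_2_eq_2\<close>)
  also have "\<dots> = 2 * (\<Sum>i<m. r 0 * (?y i * ?y i) + (\<Sum>j<i. r (i - j) * (?y j * ?y i)))"
    by (subst sum_square_split) (simp add: sum.distrib sum_distrib_left algebra_simps)
  also have "(\<Sum>i<m. r 0 * (?y i * ?y i) + (\<Sum>j<i. r (i - j) * (?y j * ?y i)))
      = (\<Sum>i<m. \<Sum>j<Suc i. r (i - j) * (?y j * ?y i))"
    by (intro sum.cong) auto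
  also have "\<dots> = (\<Sum>n=1..m. \<Sum>j=1..n. r (n - j) * (x j * x n))"
    by (simp add: sum.atLeast1_atMost_eq lessThan_Suc_atMost del: sum.lessThan_Suc)
  finally show ?thesis by simp
qed

section \<open>The fractional quadrature weights\<close>

text \<open>The quadrature weight \<open>\<lambda>\<^bsub>n,j\<^esub>\<close> divided by \<open>\<tau>\<^sup>a / \<Gamma>(2 + a)\<close>, as a function of \<open>m = n - j\<close>. For
  \<open>m \<ge> 1\<close> it is \<open>(m + 1)\<^bsup>1 + a\<^esup> - 2 m\<^bsup>1 + a\<^esup> + (m - 1)\<^bsup>1 + a\<^esup>\<close>.\<close>

definition quad_profile :: "real \<Rightarrow> nat \<Rightarrow> real" where
  "quad_profile a m = (if m = 0 then 1 else fdiff 2 (\<lambda>x. x powr (1 + a)) (real m - 1))"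

text \<open>Convexity at the diagonal is the inequality \<open>7 - 8 * 2\<^sup>a + 3 * 3\<^sup>a \<ge> 0\<close>. After division by \<open>2\<^sup>a\<close>
  the left side is a convex function of \<open>a\<close> that vanishes at \<open>a = 1\<close>, and it lies above its tangent
  there, which has negative slope because \<open>(3/2)\<^sup>9 < 2\<^sup>7\<close>.\<close>

lemma quad_profile_bound_0:
  fixes a :: real
  assumes "0 < a" "a < 1"
  shows "0 \<le> 2 * quad_profile a 0 - 2 * quad_profile a 1 + quad_profile a 2"
proof -
  have e: "2 powr (1 + a) = 2 * 2 powr a" "3 powr (1 + a) = 3 * 3 powr a"
    by (simp_all add: powr_add)
  have ln: "9 * ln (3/2) \<le> 7 * ln (2::real)"
  proof -
    have "ln ((3/2) ^ 9) \<le> ln ((2::real) ^ 7)" by (subst ln_le_cancel_iff) (simp_all add: power_divide)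
    then show ?thesis by (simp only: ln_realpow)
  qed
  have 1: "7 / 2 * (1 + (1 - a) * ln 2) \<le> 7 * 2 powr (- a)"
  proof -
    have "1 + (1 - a) * ln 2 \<le> 2 powr (1 - a)"
      using exp_ge_add_one_self[of "(1 - a) * ln 2"] by (simp add: powr_def)
    then show ?thesis by (simp add: powr_diff powr_minus field_simps)
  qed
  have 2: "9 / 2 * (1 - (1 - a) * ln (3/2)) \<le> 3 * (3/2) powr a"
  proof -
    have "1 - (1 - a) * ln (3/2) \<le> (3/2) powr (a - 1)"
      using exp_ge_add_one_self[of "(a - 1) * ln (3/2)"] by (simp add: powr_def algebra_simps)
    then show ?thesis by (simp add: powr_diff field_simps)
  qed
  have "0 \<le> (1 - a) / 2 * (7 * ln 2 - 9 * ln (3/2))" using ln assms by simp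
  also have "\<dots> = 7 / 2 * (1 + (1 - a) * ln 2) + 9 / 2 * (1 - (1 - a) * ln (3/2)) - 8"
    by (simp add: field_simps)
  also have "\<dots> \<le> 7 * 2 powr (- a) + 3 * (3/2) powr a - 8" using 1 2 by linarith
  finally have "0 \<le> 2 powr a * (7 * 2 powr (- a) + 3 * (3/2) powr a - 8)" by simp
  also have "\<dots> = 7 - 8 * 2 powr a + 3 * 3 powr a"
    by (simp add: algebra_simps powr_divide powr_minus)
  finally show ?thesis by (simp add: quad_profile_def numeral_2_eq_2 e)
qed

text \<open>The second, third and fourth derivatives of \<open>x\<^bsup>1 + a\<^esup>\<close> have the signs \<open>+\<close>, \<open>-\<close>, \<open>+\<close>, and the same
  holds for the differences of these orders.\<close>

lemma
  assumes "0 < a" "a < 1"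
  shows quad_profile_nonneg: "0 \<le> quad_profile a m"
    and quad_profile_decreasing: "1 \<le> m \<Longrightarrow> quad_profile a (Suc m) \<le> quad_profile a m"
    and quad_profile_convex: "1 \<le> m \<Longrightarrow>
        0 \<le> quad_profile a m - 2 * quad_profile a (Suc m) + quad_profile a (Suc (Suc m))"
proof -
  let ?p = "\<lambda>x. x powr (1 + a)"
  show "0 \<le> quad_profile a m"
  proof (cases "m = 0")
    case False
    then obtain \<xi> where "fdiff 2 ?p (real m - 1) = (\<Prod>i<2. 1 + a - real i) * \<xi> powr (1 + a - real 2)"
      using fdiff_powr_mean_value[of "real m - 1" "1 + a" 2] assms by auto
    then show ?thesis using False assms by (simp add: quad_profile_def eval_nat_numeral)
  qed (simp add: quad_profile_def)
  assume m: "1 \<le> m"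
  obtain \<xi> where "fdiff 3 ?p (real m - 1) = (\<Prod>i<3. 1 + a - real i) * \<xi> powr (1 + a - real 3)"
    using fdiff_powr_mean_value[of "real m - 1" "1 + a" 3] assms m by auto
  moreover have "quad_profile a (Suc m) - quad_profile a m = fdiff 3 ?p (real m - 1)"
    using m by (simp add: quad_profile_def eval_nat_numeral algebra_simps)
  moreover have "(\<Prod>i<3::nat. 1 + a - real i) = (1 + a) * a * (a - 1)"
    by (simp add: eval_nat_numeral)
  ultimately show "quad_profile a (Suc m) \<le> quad_profile a m"
    using assms mult_nonneg_nonpos[of "(1 + a) * a" "a - 1"]
      mult_nonpos_nonneg[of "(1 + a) * a * (a - 1)" "\<xi> powr (1 + a - real 3)"] by simp
  obtain \<xi> where "fdiff 4 ?p (real m - 1) = (\<Prod>i<4. 1 + a - real i) * \<xi> powr (1 + a - real 4)"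
    using fdiff_powr_mean_value[of "real m - 1" "1 + a" 4] assms m by auto
  moreover have "quad_profile a m - 2 * quad_profile a (Suc m) + quad_profile a (Suc (Suc m))
      = fdiff 4 ?p (real m - 1)"
    using m by (simp add: quad_profile_def eval_nat_numeral algebra_simps)
  moreover have "(\<Prod>i<4::nat. 1 + a - real i) = ((1 + a) * a) * ((1 - a) * (2 - a))"
    by (simp add: eval_nat_numeral algebra_simps)
  ultimately show "0 \<le> quad_profile a m - 2 * quad_profile a (Suc m) + quad_profile a (Suc (Suc m))"
    using assms by simp
qed

lemma quad_profile_psd:
  fixes x :: "nat \<Rightarrow> real"
  assumes "0 < a" "a < 1"
  shows "0 \<le> (\<Sum>n=1..m. \<Sum>j=1..n. quad_profile a (n - j) * (x j * x n))"
proof (rule causal_convex_psd)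
  have "2 powr a \<le> 2 powr 1" using assms by (intro powr_mono) auto
  then show "quad_profile a 1 \<le> 2 * quad_profile a 0"
    by (simp add: quad_profile_def eval_nat_numeral powr_add)
qed (use assms quad_profile_nonneg quad_profile_decreasing quad_profile_convex
       quad_profile_bound_0 in auto)

text \<open>The sum telescopes to \<open>n\<^bsup>1 + a\<^esup> - (n - 1)\<^bsup>1 + a\<^esup>\<close>.\<close>

lemma sum_quad_profile_le:
  assumes "0 < a" "1 \<le> n"
  shows "(\<Sum>j=1..n. quad_profile a (n - j)) \<le> (1 + a) * real n powr a"
proof -
  have "(\<Sum>j=1..n. quad_profile a (n - j)) = (\<Sum>m<n. quad_profile a m)"
    by (rule sum.reindex_bij_witness[of _ "\<lambda>m. n - m" "\<lambda>j. n - j"]) auto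
  also have "\<dots> = real n powr (1 + a) - (real n - 1) powr (1 + a)"
    using \<open>1 \<le> n\<close>
  proof (induction n rule: nat_induct_at_least)
    case base
    then show ?case using assms by (simp add: quad_profile_def)
  next
    case (Suc n)
    then show ?case by (simp add: quad_profile_def eval_nat_numeral algebra_simps)
  qed
  also have "\<dots> = fdiff 1 (\<lambda>x. x powr (1 + a)) (real n - 1)" by simp
  also have "\<dots> \<le> (1 + a) * real n powr a"
  proof -
    obtain \<xi> where "real n - 1 \<le> \<xi>" "\<xi> \<le> real n"
      "fdiff 1 (\<lambda>x. x powr (1 + a)) (real n - 1) = (\<Prod>i<1::nat. 1 + a - real i) * \<xi> powr a"
      using fdiff_powr_mean_value[of "real n - 1" "1 + a" 1] assms by auto
    then show ?thesis using assms by (auto intro!: mult_left_mono powr_mono2)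
  qed
  finally show ?thesis .
qed

lemma Gamma_one_plus: "0 < (x::real) \<Longrightarrow> Gamma (1 + x) = x * Gamma x"
  by (subst add.commute, rule Gamma_plus1) (auto elim!: nonpos_Ints_cases)

lemma has_integral_powr_shift:
  fixes a c u v :: real
  assumes "0 < a" "c \<le> u" "u \<le> v"
  shows "((\<lambda>t. (t - c) powr a) has_integral ((v - c) powr (1 + a) - (u - c) powr (1 + a)) / (1 + a)) {u..v}"
proof -
  have "((\<lambda>t. (t - c) powr a) has_integral
      (v - c) powr (1 + a) / (1 + a) - (u - c) powr (1 + a) / (1 + a)) {u..v}"
  proof (rule fundamental_theorem_of_calculus_interior[where f = "\<lambda>t. (t - c) powr (1 + a) / (1 + a)"])
    show "continuous_on {u..v} (\<lambda>t. (t - c) powr (1 + a) / (1 + a))"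
      by (intro continuous_on_divide continuous_on_powr') (use assms in \<open>auto intro!: continuous_intros\<close>)
    fix x assume "x \<in> {u<..<v}"
    then show "((\<lambda>t. (t - c) powr (1 + a) / (1 + a)) has_vector_derivative (x - c) powr a) (at x)"
      using assms unfolding has_real_derivative_iff_has_vector_derivative[symmetric]
      by (auto intro!: derivative_eq_intros)
  qed (use assms in auto)
  then show ?thesis by (simp add: diff_divide_distrib)
qed

text \<open>The kernel is unbounded at \<open>s = t\<close>, but its primitive is continuous up to that point, so the
  fundamental theorem of calculus on the open interval applies to the gauge integral.\<close>

lemma beta_kernel_primitive:
  assumes "0 < a" "u \<le> v" "v \<le> t"
  shows "integral {u..v} (\<lambda>s. beta_kernel a (t - s)) = ((t - u) powr a - (t - v) powr a) / Gamma (1 + a)"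
proof -
  have G: "Gamma (1 + a) = a * Gamma a" "Gamma a > 0"
    using assms by (simp_all add: Gamma_one_plus)
  have G0: "Gamma (1 + a) \<noteq> 0" by (metis Gamma_real_pos add_pos_pos less_irrefl zero_less_one assms(1))
  have "((\<lambda>s. beta_kernel a (t - s)) has_integral
      (- ((t - v) powr a) / Gamma (1 + a)) - (- ((t - u) powr a) / Gamma (1 + a))) {u..v}"
  proof (rule fundamental_theorem_of_calculus_interior[where f = "\<lambda>s. - ((t - s) powr a) / Gamma (1 + a)"])
    show "continuous_on {u..v} (\<lambda>s. - ((t - s) powr a) / Gamma (1 + a))"
      by (intro continuous_on_divide continuous_on_minus continuous_on_powr')
         (use assms G0 in \<open>auto intro!: continuous_intros\<close>)
    fix x assume "x \<in> {u<..<v}"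
    then show "((\<lambda>s. - ((t - s) powr a) / Gamma (1 + a)) has_vector_derivative beta_kernel a (t - x)) (at x)"
      using assms G G0 unfolding has_real_derivative_iff_has_vector_derivative[symmetric]
      by (auto intro!: derivative_eq_intros simp: beta_kernel_def)
  qed (use assms in auto)
  then show ?thesis by (simp add: integral_unique diff_divide_distrib)
qed

text \<open>The minimum in the inner integral equals \<open>t\<close> on the diagonal interval \<open>j = n\<close> and \<open>t\<^sub>j\<close> before it.
  This is why the profile at \<open>0\<close> has a single term instead of a second difference.\<close>

lemma quad_wt_eq:
  assumes "0 < a" "0 < \<tau>" "1 \<le> j" "j \<le> n"
  shows "quad_wt a \<tau> n j = \<tau> powr a / Gamma (2 + a) * quad_profile a (n - j)"
proof -
  let ?t = "tnode \<tau>"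
  have mono: "?t i \<le> ?t k" if "i \<le> k" for i k
    using that assms by (simp add: tnode_def mult_right_mono)
  have G: "Gamma (2 + a) = (1 + a) * Gamma (1 + a)" "Gamma (1 + a) > 0"
    using assms Gamma_one_plus[of "1 + a"] by simp_all
  have pw: "(?t k - ?t i) powr (1 + a) = \<tau> * \<tau> powr a * (real k - real i) powr (1 + a)"
    if "i \<le> k" for i k
    using that assms by (simp add: tnode_def left_diff_distrib[symmetric] powr_mult powr_add)
  have inner: "integral {?t (j - 1)..min t (?t j)} (\<lambda>s. beta_kernel a (t - s))
      = ((t - ?t (j - 1)) powr a - (t - min t (?t j)) powr a) / Gamma (1 + a)"
    if "t \<in> {?t (n - 1)..?t n}" for t
    using that assms mono[of "j - 1" "n - 1"] mono[of "j - 1" j]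
    by (intro beta_kernel_primitive) (auto simp: diff_le_mono)
  have I1: "((\<lambda>t. (t - ?t (j - 1)) powr a) has_integral
      ((?t n - ?t (j - 1)) powr (1 + a) - (?t (n - 1) - ?t (j - 1)) powr (1 + a)) / (1 + a))
      {?t (n - 1)..?t n}"
    using assms by (intro has_integral_powr_shift mono) auto
  show ?thesis
  proof (cases "j = n")
    case True
    have "((\<lambda>t. integral {?t (j - 1)..min t (?t j)} (\<lambda>s. beta_kernel a (t - s))) has_integral
       ((?t n - ?t (j - 1)) powr (1 + a) - (?t (n - 1) - ?t (j - 1)) powr (1 + a)) / (1 + a) / Gamma (1 + a))
       {?t (n - 1)..?t n}"
      by (rule has_integral_eq[OF _ has_integral_divide[OF I1]])
         (use inner True assms in \<open>auto simp: min_def\<close>)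
    then have "integral {?t (n - 1)..?t n} (\<lambda>t. integral {?t (j - 1)..min t (?t j)} (\<lambda>s. beta_kernel a (t - s)))
       = \<tau> * \<tau> powr a / Gamma (2 + a)"
      using True assms by (simp add: integral_unique pw G)
    then show ?thesis using True assms by (simp add: quad_wt_def quad_profile_def)
  next
    case False
    then have jn: "j \<le> n - 1" using assms by simp
    have I2: "((\<lambda>t. (t - ?t j) powr a) has_integral
      ((?t n - ?t j) powr (1 + a) - (?t (n - 1) - ?t j) powr (1 + a)) / (1 + a)) {?t (n - 1)..?t n}"
      using assms jn by (intro has_integral_powr_shift mono) auto
    have "((\<lambda>t. integral {?t (j - 1)..min t (?t j)} (\<lambda>s. beta_kernel a (t - s))) has_integral
       (((?t n - ?t (j - 1)) powr (1 + a) - (?t (n - 1) - ?t (j - 1)) powr (1 + a)) / (1 + a)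
       - ((?t n - ?t j) powr (1 + a) - (?t (n - 1) - ?t j) powr (1 + a)) / (1 + a)) / Gamma (1 + a))
       {?t (n - 1)..?t n}"
      by (rule has_integral_eq[OF _ has_integral_divide[OF has_integral_diff[OF I1 I2]]])
         (use inner mono[OF jn] assms in \<open>auto simp: min_def\<close>)
    moreover have "quad_profile a (n - j) = (real n - real (j - 1)) powr (1 + a)
        - (real (n - 1) - real (j - 1)) powr (1 + a)
        - ((real n - real j) powr (1 + a) - (real (n - 1) - real j) powr (1 + a))"
      using jn False assms by (simp add: quad_profile_def eval_nat_numeral of_nat_diff algebra_simps)
    moreover have "((c * p - c * q) / (1 + a) - (c * r - c * s) / (1 + a)) / Gamma (1 + a)
        = c / Gamma (2 + a) * (p - q - (r - s))" for c p q r s :: real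
      unfolding G(1) by (simp add: divide_simps) (simp add: algebra_simps)
    ultimately have "integral {?t (n - 1)..?t n} (\<lambda>t. integral {?t (j - 1)..min t (?t j)} (\<lambda>s. beta_kernel a (t - s)))
       = \<tau> * \<tau> powr a / Gamma (2 + a) * quad_profile a (n - j)"
      using jn assms by (simp only: integral_unique pw diff_le_mono order.trans[OF diff_le_self])
    then show ?thesis using assms by (simp add: quad_wt_def)
  qed
qed

lemma quad_wt_nonneg:
  assumes "0 < a" "a < 1" "0 < \<tau>" "1 \<le> j" "j \<le> n"
  shows "0 \<le> quad_wt a \<tau> n j"
  using assms quad_profile_nonneg[of a] by (simp add: quad_wt_eq)

lemma quad_wt_psd:
  fixes x :: "nat \<Rightarrow> real"
  assumes "0 < a" "a < 1" "0 < \<tau>"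
  shows "0 \<le> (\<Sum>n=1..m. \<Sum>j=1..n. quad_wt a \<tau> n j * (x j * x n))"
proof -
  have "(\<Sum>n=1..m. \<Sum>j=1..n. quad_wt a \<tau> n j * (x j * x n))
     = \<tau> powr a / Gamma (2 + a) * (\<Sum>n=1..m. \<Sum>j=1..n. quad_profile a (n - j) * (x j * x n))"
    unfolding sum_distrib_left using assms by (intro sum.cong refl) (simp add: quad_wt_eq)
  then show ?thesis using quad_profile_psd[of a x m] assms by (simp add: Gamma_real_pos)
qed

lemma sum_quad_wt_le:
  assumes "0 < a" "0 < \<tau>" "1 \<le> n"
  shows "(\<Sum>j=1..n. quad_wt a \<tau> n j) \<le> (\<tau> * real n) powr a / Gamma (1 + a)"
proof -
  have G: "Gamma (2 + a) = (1 + a) * Gamma (1 + a)" "Gamma (1 + a) > 0"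
    using assms Gamma_one_plus[of "1 + a"] by simp_all
  have "(\<Sum>j=1..n. quad_wt a \<tau> n j) = \<tau> powr a / Gamma (2 + a) * (\<Sum>j=1..n. quad_profile a (n - j))"
    unfolding sum_distrib_left using assms by (intro sum.cong refl) (simp add: quad_wt_eq)
  also have "\<dots> \<le> \<tau> powr a / Gamma (2 + a) * ((1 + a) * real n powr a)"
    using assms G by (intro mult_left_mono sum_quad_profile_le) auto
  also have "\<dots> = (\<tau> * real n) powr a / Gamma (1 + a)"
    using assms G by (simp add: powr_mult)
  finally show ?thesis .
qed

section \<open>The memory weights\<close>

text \<open>A primitive of \<open>1 + 2 * \<bar>ln T\<bar> - ln t\<close>, which dominates \<open>\<bar>ln t\<bar> + 1\<close> on \<open>(0, T]\<close>. It tends to \<open>0\<close> at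
  the origin, which expresses that the logarithmic singularity is integrable.\<close>

definition log_primitive :: "real \<Rightarrow> real \<Rightarrow> real" where
  "log_primitive T t = t * (2 + 2 * \<bar>ln T\<bar> - ln t)"

lemma abs_ln_le:
  fixes t T :: real
  assumes "0 < t" "t \<le> T"
  shows "\<bar>ln t\<bar> + 1 \<le> 1 + 2 * \<bar>ln T\<bar> - ln t"
proof -
  have "ln t \<le> ln T" using assms by simp
  then show ?thesis by linarith
qed

lemma log_primitive_has_derivative:
  assumes "0 < t"
  shows "(log_primitive T has_real_derivative 1 + 2 * \<bar>ln T\<bar> - ln t) (at t)"
  unfolding log_primitive_def[abs_def] using assms
  by (auto intro!: derivative_eq_intros simp: field_simps)

lemma log_primitive_mono:
  assumes "0 < s" "s \<le> t" "t \<le> T"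
  shows "log_primitive T s \<le> log_primitive T t"
proof (rule DERIV_nonneg_imp_nondecreasing[OF \<open>s \<le> t\<close>])
  fix x assume "s \<le> x" "x \<le> t"
  then show "\<exists>y. (log_primitive T has_real_derivative y) (at x) \<and> 0 \<le> y"
    using log_primitive_has_derivative[of x T] abs_ln_le[of x T] assms by fastforce
qed

lemma log_primitive_nonneg:
  assumes "0 < t" "t \<le> T"
  shows "0 \<le> log_primitive T t"
  using abs_ln_le[OF assms] assms by (auto simp: log_primitive_def intro!: mult_nonneg_nonneg)

text \<open>Both \<open>Q * log_primitive T - h\<close> and \<open>Q * log_primitive T + h\<close> are nondecreasing. This comparison
  takes the place of integrating \<open>\<bar>h'\<bar>\<close>.\<close>

lemma log_bounded_derivative_variation:
  fixes h h' :: "real \<Rightarrow> real"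
  assumes st: "0 < s" "s \<le> t" "t \<le> T"
    and h: "\<And>x. x \<in> {0<..T} \<Longrightarrow> (h has_real_derivative h' x) (at x within {0..T})"
    and h': "\<And>x. x \<in> {0<..T} \<Longrightarrow> \<bar>h' x\<bar> \<le> Q * (\<bar>ln x\<bar> + 1)"
    and Q: "0 \<le> Q"
  shows "\<bar>h t - h s\<bar> \<le> Q * (log_primitive T t - log_primitive T s)"
proof -
  have cont: "continuous_on {s..t} h"
    by (rule DERIV_continuous_on[of _ _ h'], rule has_field_derivative_subset[OF h]) (use st in auto)
  have contL: "continuous_on {s..t} (log_primitive T)"
    by (rule DERIV_continuous_on, rule has_field_derivative_at_within[OF log_primitive_has_derivative])
       (use st in auto)
  have dh: "(h has_real_derivative h' x) (at x)" if "s < x" "x < t" for x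
    using h[of x] that st at_within_Icc_at[of 0 x T] by simp
  have bound: "\<bar>h' x\<bar> \<le> Q * (1 + 2 * \<bar>ln T\<bar> - ln x)" if "s < x" "x < t" for x
    using h'[of x] mult_left_mono[OF abs_ln_le[of x T] Q] that st by auto
  have "Q * log_primitive T s - h s \<le> Q * log_primitive T t - h t"
  proof (rule DERIV_nonneg_imp_increasing_open[OF \<open>s \<le> t\<close>])
    fix x assume x: "s < x" "x < t"
    have "((\<lambda>x. Q * log_primitive T x - h x) has_real_derivative
        Q * (1 + 2 * \<bar>ln T\<bar> - ln x) - h' x) (at x)"
      using x st by (intro DERIV_diff DERIV_cmult log_primitive_has_derivative dh) auto
    then show "\<exists>y. ((\<lambda>x. Q * log_primitive T x - h x) has_real_derivative y) (at x) \<and> 0 \<le> y"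
      using bound[OF x] by (intro exI conjI) auto
  qed (intro continuous_intros cont contL)
  moreover have "Q * log_primitive T s + h s \<le> Q * log_primitive T t + h t"
  proof (rule DERIV_nonneg_imp_increasing_open[OF \<open>s \<le> t\<close>])
    fix x assume x: "s < x" "x < t"
    have "((\<lambda>x. Q * log_primitive T x + h x) has_real_derivative
        Q * (1 + 2 * \<bar>ln T\<bar> - ln x) + h' x) (at x)"
      using x st by (intro DERIV_add DERIV_cmult log_primitive_has_derivative dh) auto
    then show "\<exists>y. ((\<lambda>x. Q * log_primitive T x + h x) has_real_derivative y) (at x) \<and> 0 \<le> y"
      using bound[OF x] by (intro exI conjI) auto
  qed (intro continuous_intros cont contL)
  ultimately show ?thesis by (simp add: algebra_simps abs_le_iff)
qed

lemma tnode_le: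
  assumes "0 < \<tau>" "\<tau> * real N \<le> T" "k \<le> N"
  shows "tnode \<tau> k \<le> T"
proof -
  have "real k * \<tau> \<le> real N * \<tau>" using assms by (intro mult_right_mono) auto
  also have "\<dots> \<le> T" using assms by (simp add: mult.commute)
  finally show ?thesis by (simp add: tnode_def)
qed

text \<open>By the mean value theorem \<open>w\<^sub>k = \<tau> g'(\<xi>\<^sub>k)\<close> with \<open>\<xi>\<^sub>k\<close> in the \<open>k\<close>-th open time interval. Since the \<open>\<xi>\<^sub>k\<close>
  are positive and increasing, the sum of the \<open>\<bar>w\<^sub>j - w\<^bsub>j - 1\<^esub>\<bar>\<close> is \<open>\<tau>\<close> times a variation of \<open>g'\<close>,
  and its bound telescopes.\<close>

lemma w_coeff_bounds:
  assumes g: "g_bounds T Q g" and T: "0 < T" and \<tau>: "0 < \<tau>" "\<tau> * real N \<le> T"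
  shows w_coeff_le: "k < N \<Longrightarrow> \<bar>w_coeff \<tau> g k\<bar> \<le> Q * \<tau>"
    and w_coeff_variation: "m < N \<Longrightarrow>
      (\<Sum>j=1..m. \<bar>w_coeff \<tau> g j - w_coeff \<tau> g (j - 1)\<bar>) \<le> \<tau> * Q * log_primitive T T"
proof -
  obtain g1 g2 where
        g1: "\<And>t. t \<in> {0..T} \<Longrightarrow> (g has_real_derivative g1 t) (at t within {0..T})"
    and gb: "\<And>t. t \<in> {0..T} \<Longrightarrow> \<bar>g1 t\<bar> \<le> Q"
    and g2: "\<And>t. t \<in> {0<..T} \<Longrightarrow> (g1 has_real_derivative g2 t) (at t within {0..T})"
    and g2b: "\<And>t. t \<in> {0<..T} \<Longrightarrow> \<bar>g2 t\<bar> \<le> Q * (\<bar>ln t\<bar> + 1)"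
    using g unfolding g_bounds_def by blast
  have Q: "0 \<le> Q" using gb[of 0] T by auto
  have "\<exists>\<xi>. tnode \<tau> k < \<xi> \<and> \<xi> < tnode \<tau> (Suc k) \<and> w_coeff \<tau> g k = \<tau> * g1 \<xi>" if "k < N" for k
  proof -
    have lt: "tnode \<tau> k < tnode \<tau> (Suc k)" "0 \<le> tnode \<tau> k" using \<tau> by (auto simp: tnode_def)
    have le: "tnode \<tau> (Suc k) \<le> T"
      using tnode_le[OF \<tau>, of "Suc k"] that by simp
    have "continuous_on {tnode \<tau> k..tnode \<tau> (Suc k)} g"
      by (rule DERIV_continuous_on[of _ _ g1], rule has_field_derivative_subset[OF g1]) (use lt le in auto)
    moreover have dg: "(g has_real_derivative g1 x) (at x)" if "tnode \<tau> k < x" "x < tnode \<tau> (Suc k)" for x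
      using g1[of x] that lt le at_within_Icc_at[of 0 x T] by simp
    moreover have "g differentiable (at x)" if "tnode \<tau> k < x" "x < tnode \<tau> (Suc k)" for x
      using dg[OF that] by (auto simp: real_differentiable_def)
    ultimately obtain l z where z: "tnode \<tau> k < z" "z < tnode \<tau> (Suc k)"
        "(g has_real_derivative l) (at z)"
        "g (tnode \<tau> (Suc k)) - g (tnode \<tau> k) = (tnode \<tau> (Suc k) - tnode \<tau> k) * l"
      using MVT[OF lt(1), of g] by blast
    have "l = g1 z" using DERIV_unique[OF z(3) dg] z by simp
    then show ?thesis using z by (auto simp: w_coeff_def tnode_def algebra_simps)
  qed
  then obtain \<xi> where \<xi>: "\<And>k. k < N \<Longrightarrow> tnode \<tau> k < \<xi> k" "\<And>k. k < N \<Longrightarrow> \<xi> k < tnode \<tau> (Suc k)"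
      and w: "\<And>k. k < N \<Longrightarrow> w_coeff \<tau> g k = \<tau> * g1 (\<xi> k)"
    by metis
  have pos: "0 < \<xi> k" if "k < N" for k
    using \<xi>(1)[OF that] \<tau> order.strict_trans1[of 0 "tnode \<tau> k" "\<xi> k"] by (simp add: tnode_def)
  have leT: "\<xi> k \<le> T" if "k < N" for k
  proof -
    have "tnode \<tau> (Suc k) \<le> T"
      using tnode_le[OF \<tau>, of "Suc k"] that by simp
    then show ?thesis using \<xi>(2)[OF that] by simp
  qed
  show "\<bar>w_coeff \<tau> g k\<bar> \<le> Q * \<tau>" if "k < N"
    using gb[of "\<xi> k"] pos[OF that] leT[OF that] \<tau> by (simp add: w[OF that] abs_mult mult.commute)
  assume m: "m < N"
  have "(\<Sum>j=1..m. \<bar>w_coeff \<tau> g j - w_coeff \<tau> g (j - 1)\<bar>)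
      \<le> \<tau> * Q * (log_primitive T (\<xi> m) - log_primitive T (\<xi> 0))" using m
  proof (induction m)
    case (Suc m)
    have "\<bar>g1 (\<xi> (Suc m)) - g1 (\<xi> m)\<bar> \<le> Q * (log_primitive T (\<xi> (Suc m)) - log_primitive T (\<xi> m))"
      by (rule log_bounded_derivative_variation[OF _ _ _ g2 g2b])
         (use Suc.prems pos[of m] leT[of "Suc m"] \<xi>(2)[of m] \<xi>(1)[of "Suc m"] Q in auto)
    then have "\<bar>w_coeff \<tau> g (Suc m) - w_coeff \<tau> g m\<bar>
        \<le> \<tau> * (Q * (log_primitive T (\<xi> (Suc m)) - log_primitive T (\<xi> m)))"
      using Suc.prems \<tau> w[of m] w[of "Suc m"]
      by (simp add: right_diff_distrib[symmetric] abs_mult)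
    then show ?case using Suc by (simp add: algebra_simps)
  qed simp
  also have "\<dots> \<le> \<tau> * Q * log_primitive T T"
    using log_primitive_mono[OF pos[OF m] leT[OF m], of T] log_primitive_nonneg[OF pos leT, of 0] m \<tau> Q
    by (intro mult_left_mono) auto
  finally show "(\<Sum>j=1..m. \<bar>w_coeff \<tau> g j - w_coeff \<tau> g (j - 1)\<bar>) \<le> \<tau> * Q * log_primitive T T" .
qed

lemma summation_by_parts_bound:
  fixes c p :: "nat \<Rightarrow> real"
  assumes p: "\<And>k. k \<le> m \<Longrightarrow> \<bar>p k\<bar> \<le> M" and m: "1 \<le> m"
  shows "\<bar>\<Sum>k=1..m. c k * (p k - p (k - 1))\<bar>
    \<le> (\<bar>c 1\<bar> + \<bar>c m\<bar> + (\<Sum>k=2..m. \<bar>c k - c (k - 1)\<bar>)) * M"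
proof -
  have "(\<Sum>k=1..m. c k * (p k - p (k - 1)))
      = c m * p m - c 1 * p 0 - (\<Sum>k=2..m. (c k - c (k - 1)) * p (k - 1))"
    using m by (induction m rule: nat_induct_at_least) (auto simp: algebra_simps)
  moreover have "\<bar>\<Sum>k=2..m. (c k - c (k - 1)) * p (k - 1)\<bar> \<le> (\<Sum>k=2..m. \<bar>c k - c (k - 1)\<bar> * M)"
    by (rule order.trans[OF sum_abs], rule sum_mono)
       (auto simp: abs_mult intro!: mult_left_mono p)
  moreover have "\<bar>c m * p m\<bar> \<le> \<bar>c m\<bar> * M" "\<bar>c 1 * p 0\<bar> \<le> \<bar>c 1\<bar> * M"
    by (auto simp: abs_mult intro!: mult_left_mono p)
  ultimately show ?thesis by (simp add: distrib_right sum_distrib_right)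
qed

text \<open>The difference quotients of the solution carry a factor \<open>1 / \<tau>\<close>, here cancelled in advance; the
  bound still has a factor \<open>\<tau>\<close>, so that adding up the time levels gives a bounded total.\<close>

lemma memory_term_bound:
  fixes p :: "nat \<Rightarrow> real"
  assumes g: "g_bounds T Q g" and T: "0 < T" and \<tau>: "0 < \<tau>" "\<tau> * real N \<le> T"
    and n: "2 \<le> n" "n \<le> N" and p: "\<And>k. k < n \<Longrightarrow> \<bar>p k\<bar> \<le> M"
  shows "\<bar>\<Sum>k=1..n-1. w_avg \<tau> g (n - k) * (p k - p (k - 1))\<bar>
    \<le> \<tau> * (Q * (2 + log_primitive T T)) * M"
proof -
  let ?w = "w_coeff \<tau> g" and ?c = "\<lambda>k. w_avg \<tau> g (n - k)"
  have M: "0 \<le> M" using p[of 0] n by simp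
  have w1: "\<bar>w_avg \<tau> g j\<bar> \<le> \<tau> * Q" if "j < N" for j
    using w_coeff_le[OF g T \<tau>, of j] w_coeff_le[OF g T \<tau>, of "j - 1"] less_imp_diff_less[OF that, of 1] that
      abs_triangle_ineq[of "?w j" "?w (j - 1)"]
    by (simp add: w_avg_def mult.commute)
  have "(\<Sum>k=2..n-1. \<bar>?c k - ?c (k - 1)\<bar>) = (\<Sum>j=2..n-1. \<bar>w_avg \<tau> g (j - 1) - w_avg \<tau> g j\<bar>)"
    by (rule sum.reindex_bij_witness[of _ "\<lambda>j. n + 1 - j" "\<lambda>k. n + 1 - k"])
       (use n in \<open>auto simp: Suc_diff_le\<close>)
  also have "\<dots> \<le> (\<Sum>j=2..n-1. \<bar>?w j - ?w (j - 1)\<bar> / 2 + \<bar>?w (j - 1) - ?w (j - 1 - 1)\<bar> / 2)"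
  proof (rule sum_mono)
    have "\<bar>(b + c) / 2 - (a + b) / 2\<bar> \<le> \<bar>a - b\<bar> / 2 + \<bar>b - c\<bar> / 2" for a b c :: real
      using abs_triangle_ineq[of "(b - a) / 2" "(c - b) / 2"] by (simp add: field_simps abs_minus_commute)
    then show "\<bar>w_avg \<tau> g (j - 1) - w_avg \<tau> g j\<bar>
        \<le> \<bar>?w j - ?w (j - 1)\<bar> / 2 + \<bar>?w (j - 1) - ?w (j - 1 - 1)\<bar> / 2" for j
      unfolding w_avg_def .
  qed
  also have "\<dots> = (\<Sum>j=2..n-1. \<bar>?w j - ?w (j - 1)\<bar>) / 2 + (\<Sum>j=2..n-1. \<bar>?w (j - 1) - ?w (j - 1 - 1)\<bar>) / 2"
    by (simp add: sum.distrib sum_divide_distrib)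
  also have "(\<Sum>j=2..n-1. \<bar>?w j - ?w (j - 1)\<bar>) \<le> (\<Sum>j=1..n-1. \<bar>?w j - ?w (j - 1)\<bar>)"
    by (rule sum_mono2) auto
  also have "(\<Sum>j=1..n-1. \<bar>?w j - ?w (j - 1)\<bar>) \<le> \<tau> * Q * log_primitive T T"
    by (rule w_coeff_variation[OF g T \<tau>]) (use n in simp)
  also have "(\<Sum>j=2..n-1. \<bar>?w (j - 1) - ?w (j - 1 - 1)\<bar>) = (\<Sum>j=1..n-2. \<bar>?w j - ?w (j - 1)\<bar>)"
    by (rule sum.reindex_bij_witness[of _ "\<lambda>j. j + 1" "\<lambda>k. k - 1"]) (use n in auto)
  also have "\<dots> \<le> \<tau> * Q * log_primitive T T"
    by (rule w_coeff_variation[OF g T \<tau>]) (use n in simp)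
  finally have var: "(\<Sum>k=2..n-1. \<bar>?c k - ?c (k - 1)\<bar>) \<le> \<tau> * Q * log_primitive T T"
    by linarith
  have "\<bar>\<Sum>k=1..n-1. ?c k * (p k - p (k - 1))\<bar>
      \<le> (\<bar>?c 1\<bar> + \<bar>?c (n - 1)\<bar> + (\<Sum>k=2..n-1. \<bar>?c k - ?c (k - 1)\<bar>)) * M"
    by (rule summation_by_parts_bound) (use p n in auto)
  also have "\<dots> \<le> (\<tau> * Q + \<tau> * Q + \<tau> * Q * log_primitive T T) * M"
    using var w1[of "n - 1"] w1[of 1] n by (intro mult_right_mono[OF _ M] add_mono) auto
  finally show ?thesis by (simp add: algebra_simps)
qed

section \<open>The energy inequality in time\<close>

text \<open>The sum contains the unknown \<open>y m\<close> itself, which is absorbed on the left because \<open>\<theta> \<le> 1 / 2\<close>;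
  this costs a factor \<open>1 / (1 - \<theta>) \<le> 1 + 2 * \<theta>\<close> per step.\<close>

lemma discrete_gronwall:
  fixes y :: "nat \<Rightarrow> real"
  assumes \<theta>: "0 \<le> \<theta>" "\<theta> \<le> 1 / 2"
    and y: "\<And>m. m \<le> N \<Longrightarrow> y m \<le> Y + \<theta> * (\<Sum>n=1..m. y n)"
    and m: "m \<le> N" and Y: "0 \<le> Y"
  shows "y m \<le> Y * exp (2 * \<theta> * real m)"
proof -
  have "Y + \<theta> * (\<Sum>n=1..m. y n) \<le> Y * exp (2 * \<theta> * real m)" using m
  proof (induction m)
    case (Suc m)
    let ?s = "\<lambda>m. Y + \<theta> * (\<Sum>n=1..m. y n)" and ?e = "Y * exp (2 * \<theta> * real m)"
    have "\<theta> * y (Suc m) \<le> \<theta> * ?s (Suc m)" using y[OF Suc.prems] \<theta> by (intro mult_left_mono) auto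
    then have "(1 - \<theta>) * ?s (Suc m) \<le> ?s m" by (simp add: algebra_simps)
    also have "\<dots> \<le> ?e" using Suc by simp
    also have "\<dots> \<le> (1 - \<theta>) * ((1 + 2 * \<theta>) * ?e)"
    proof -
      have "0 \<le> (\<theta> * (1 - 2 * \<theta>)) * ?e" using \<theta> Y by (intro mult_nonneg_nonneg) auto
      then show ?thesis by (simp add: algebra_simps)
    qed
    finally have "?s (Suc m) \<le> (1 + 2 * \<theta>) * ?e" using \<theta> by simp
    also have "\<dots> \<le> exp (2 * \<theta>) * ?e"
      using \<theta> Y exp_ge_add_one_self[of "2 * \<theta>"] by (intro mult_right_mono) auto
    finally show ?case by (simp add: algebra_simps exp_add)
  qed simp
  with y[OF m] show ?thesis by simp
qed

text \<open>The scheme reduced to scalars: \<open>e n\<close> is the energy at level \<open>n\<close>, \<open>p k n\<close> is the product of level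
  \<open>k\<close> with the \<open>n\<close>-th test function, and \<open>P\<close> and \<open>R\<close> stand for the diffusion and the source.
  Estimating every energy at a level up to \<open>n\<close> by the running maximum turns the memory and the
  source into \<open>O(\<tau>)\<close> times that maximum. The right side of the resulting inequality is monotone in
  the level, so the maximum itself satisfies it.\<close>

lemma memory_energy_bound:
  fixes e P R :: "nat \<Rightarrow> real" and p :: "nat \<Rightarrow> nat \<Rightarrow> real"
  assumes g: "g_bounds T Q g" and T: "0 < T" and \<tau>: "0 < \<tau>" "\<tau> * real N \<le> T"
    and \<kappa>: "\<kappa> = 6 * (Q * (2 + log_primitive T T)) + 4 * C" "\<tau> * \<kappa> \<le> 1 / 2" "Q * \<tau> \<le> 1"
    and C: "0 \<le> C" and D: "0 \<le> D" and e: "\<And>n. n \<le> N \<Longrightarrow> 0 \<le> e n"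
    and diag: "\<And>n. 1 \<le> n \<Longrightarrow> n \<le> N \<Longrightarrow> (e n - e (n - 1)) / 2 \<le> p n n - p (n - 1) n"
    and p: "\<And>k n. 1 \<le> n \<Longrightarrow> k < n \<Longrightarrow> n \<le> N \<Longrightarrow> \<bar>p k n\<bar> \<le> (e k + (e n + e (n - 1))) / 2"
    and scheme: "\<And>n. 1 \<le> n \<Longrightarrow> n \<le> N \<Longrightarrow>
        c0_coeff \<tau> g * (p n n - p (n - 1) n)
        + (\<Sum>k=1..n-1. w_avg \<tau> g (n - k) * (p k n - p (k - 1) n)) + \<tau> * P n = \<tau> * R n"
    and P: "\<And>m. m \<le> N \<Longrightarrow> 0 \<le> (\<Sum>n=1..m. P n)"
    and R: "\<And>n M. 1 \<le> n \<Longrightarrow> n \<le> N \<Longrightarrow> (\<And>k. k \<le> n \<Longrightarrow> e k \<le> M) \<Longrightarrow> R n \<le> C * (M + D)"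
    and m: "m \<le> N"
  shows "e m \<le> (e 0 + D) * exp (2 * T * \<kappa>)"
proof -
  let ?W = "Q * (2 + log_primitive T T)" and ?c = "c0_coeff \<tau> g"
  define E where "E n = Max (e ` {..n})" for n
  have eE: "e k \<le> E n" if "k \<le> n" for k n
    unfolding E_def using that by (intro Max_ge) auto
  have E0: "0 \<le> E n" for n using e[of 0] eE[of 0 n] by simp
  have Q: "0 \<le> Q"
    using g T unfolding g_bounds_def by (meson abs_ge_zero atLeastAtMost_iff less_imp_le order.refl order.trans)
  have L: "0 \<le> log_primitive T T" using T by (intro log_primitive_nonneg) auto
  have W: "0 \<le> ?W" using Q L by simp
  have \<kappa>0: "0 \<le> \<kappa>" unfolding \<kappa>(1) using W C by simp
  have step: "?c * ((e n - e (n - 1)) / 2) \<le> \<tau> * ((3/2 * ?W + C) * (E n + D)) - \<tau> * P n"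
    and c: "1 / 2 \<le> ?c"
    if n: "1 \<le> n" "n \<le> N" for n
  proof -
    show c: "1 / 2 \<le> ?c" using w_coeff_le[OF g T \<tau>, of 0] n \<kappa>(3) by (simp add: c0_coeff_def)
    have pb: "\<bar>p k n\<bar> \<le> 3 / 2 * E n" if "k < n" for k
      using p[OF n(1) that n(2)] eE[of k n] eE[of n n] eE[of "n - 1" n] that by simp
    have mem: "\<bar>\<Sum>k=1..n-1. w_avg \<tau> g (n - k) * (p k n - p (k - 1) n)\<bar> \<le> \<tau> * ?W * (3 / 2 * E n)"
    proof (cases "n = 1")
      case True
      then show ?thesis using \<tau> W E0[of n] by simp
    next
      case False
      then show ?thesis
        by (intro memory_term_bound[OF g T \<tau>]) (use n pb in auto)
    qed
    have "?c * ((e n - e (n - 1)) / 2) \<le> ?c * (p n n - p (n - 1) n)"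
      using diag[OF n] c by (intro mult_left_mono) auto
    also have "\<dots> \<le> \<tau> * ?W * (3 / 2 * E n) + \<tau> * R n - \<tau> * P n"
      using scheme[OF n] mem by linarith
    also have "\<dots> \<le> \<tau> * ?W * (3 / 2 * (E n + D)) + \<tau> * (C * (E n + D)) - \<tau> * P n"
      using R[OF n eE] \<tau> W D by (intro diff_right_mono add_mono mult_left_mono) auto
    also have "\<tau> * w * (3 / 2 * x) + \<tau> * (C * x) = \<tau> * ((3/2 * w + C) * x)" for w x
      by (simp add: algebra_simps)
    finally show "?c * ((e n - e (n - 1)) / 2) \<le> \<tau> * ((3/2 * ?W + C) * (E n + D)) - \<tau> * P n" .
  qed
  \<comment> \<open>If \<open>e m \<le> e 0\<close> there is nothing to prove; otherwise \<open>c\<^sub>0 \<ge> 1 / 2\<close> may be divided out, which turns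
    \<open>\<kappa> / 4\<close> into \<open>\<kappa>\<close>.\<close>
  have em: "e m \<le> e 0 + \<tau> * \<kappa> * (\<Sum>n=1..m. E n + D)" if "m \<le> N" for m
  proof (cases "m = 0")
    case False
    let ?S = "\<Sum>n=1..m. E n + D"
    have S0: "0 \<le> ?S" using E0 D by (intro sum_nonneg add_nonneg_nonneg) auto
    have tel: "(\<Sum>n=1..m. e n - e (n - 1)) = e m - e 0"
      by (induction m) auto
    have "?c * ((e m - e 0) / 2) = (\<Sum>n=1..m. ?c * ((e n - e (n - 1)) / 2))"
      by (simp add: tel[symmetric] sum_distrib_left sum_divide_distrib)
    also have "\<dots> \<le> (\<Sum>n=1..m. \<tau> * ((3/2 * ?W + C) * (E n + D)) - \<tau> * P n)"
      using step that by (intro sum_mono) auto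
    also have "\<dots> = \<tau> * (3/2 * ?W + C) * ?S - \<tau> * (\<Sum>n=1..m. P n)"
      by (simp only: sum_subtractf sum_distrib_left mult.assoc)
    also have "\<dots> \<le> \<tau> * (3/2 * ?W + C) * ?S" using P[OF that] \<tau> by simp
    also have "\<dots> = \<tau> * \<kappa> * ?S / 4" by (simp add: \<kappa>(1) algebra_simps)
    finally have *: "?c * ((e m - e 0) / 2) \<le> \<tau> * \<kappa> * ?S / 4" .
    have "e m - e 0 \<le> \<tau> * \<kappa> * ?S"
    proof (cases "e m \<le> e 0")
      case True
      have "0 \<le> \<tau> * \<kappa> * ?S" using \<tau> \<kappa>0 S0 by simp
      with True show ?thesis by linarith
    next
      case False
      then have "1 / 2 * ((e m - e 0) / 2) \<le> ?c * ((e m - e 0) / 2)"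
        using c[of 1] that \<open>m \<noteq> 0\<close> by (intro mult_right_mono) auto
      with * show ?thesis by simp
    qed
    then show ?thesis by simp
  qed (simp)
  have "E m + D \<le> (e 0 + D) * exp (2 * (\<tau> * \<kappa>) * real m)"
  proof (rule discrete_gronwall[where N = N])
    fix m assume "m \<le> N"
    have "e k \<le> e 0 + \<tau> * \<kappa> * (\<Sum>n=1..m. E n + D)" if "k \<le> m" for k
    proof -
      have "(\<Sum>n=1..k. E n + D) \<le> (\<Sum>n=1..m. E n + D)"
        using that E0 D by (intro sum_mono2) auto
      then have "\<tau> * \<kappa> * (\<Sum>n=1..k. E n + D) \<le> \<tau> * \<kappa> * (\<Sum>n=1..m. E n + D)"
        using \<tau> \<kappa>0 by (intro mult_left_mono) auto
      then show ?thesis using em[of k] that \<open>m \<le> N\<close> by simp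
    qed
    then have "E m \<le> e 0 + \<tau> * \<kappa> * (\<Sum>n=1..m. E n + D)"
      unfolding E_def by (subst Max_le_iff) auto
    then show "E m + D \<le> (e 0 + D) + \<tau> * \<kappa> * (\<Sum>n=1..m. E n + D)" by simp
  qed (use \<tau> \<kappa> \<kappa>0 m e[of 0] D in auto)
  also have "\<dots> \<le> (e 0 + D) * exp (2 * T * \<kappa>)"
  proof -
    have "\<tau> * real m \<le> T" using tnode_le[OF \<tau> m] by (simp add: tnode_def mult.commute)
    then have "(\<tau> * real m) * \<kappa> \<le> T * \<kappa>" using \<kappa>0 by (rule mult_right_mono)
    then show ?thesis using e[of 0] D by (intro mult_left_mono) (auto simp: mult_ac)
  qed
  finally show ?thesis using eE[of m m] D by simp
qed

section \<open>Quadratic forms of the compact difference operators\<close>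

definition vanishes_on_boundary :: "nat \<Rightarrow> nat \<Rightarrow> gridfun \<Rightarrow> bool" where
  "vanishes_on_boundary Mx My v \<longleftrightarrow> (\<forall>(i, j)\<in>boundary_idx Mx My. v i j = 0)"

lemma vanishes_on_boundaryD:
  assumes "vanishes_on_boundary Mx My v"
  shows "j \<le> My \<Longrightarrow> v 0 j = 0" "j \<le> My \<Longrightarrow> v Mx j = 0"
    "i \<le> Mx \<Longrightarrow> v i 0 = 0" "i \<le> Mx \<Longrightarrow> v i My = 0"
proof -
  have "v i j = 0" if "i \<le> Mx" "j \<le> My" "i = 0 \<or> i = Mx \<or> j = 0 \<or> j = My" for i j
  proof -
    have "(i, j) \<in> boundary_idx Mx My"
      using that by (auto simp: boundary_idx_def all_idx_def interior_idx_def)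
    then show ?thesis using assms by (auto simp: vanishes_on_boundary_def)
  qed
  then show "j \<le> My \<Longrightarrow> v 0 j = 0" "j \<le> My \<Longrightarrow> v Mx j = 0"
    "i \<le> Mx \<Longrightarrow> v i 0 = 0" "i \<le> Mx \<Longrightarrow> v i My = 0"
    by simp_all
qed

definition mass_form :: "nat \<Rightarrow> nat \<Rightarrow> gridfun \<Rightarrow> gridfun \<Rightarrow> real" where
  "mass_form Mx My v w = (\<Sum>i=1..Mx-1. \<Sum>j=1..My-1. v i j * w i j)"

definition grad_x_form :: "nat \<Rightarrow> nat \<Rightarrow> gridfun \<Rightarrow> gridfun \<Rightarrow> real" where
  "grad_x_form Mx My v w =
     (\<Sum>i<Mx. \<Sum>j=1..My-1. (v (i + 1) j - v i j) * (w (i + 1) j - w i j))"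

definition grad_y_form :: "nat \<Rightarrow> nat \<Rightarrow> gridfun \<Rightarrow> gridfun \<Rightarrow> real" where
  "grad_y_form Mx My v w =
     (\<Sum>i=1..Mx-1. \<Sum>j<My. (v i (j + 1) - v i j) * (w i (j + 1) - w i j))"

definition grad_xy_form :: "nat \<Rightarrow> nat \<Rightarrow> gridfun \<Rightarrow> gridfun \<Rightarrow> real" where
  "grad_xy_form Mx My v w =
     (\<Sum>i<Mx. \<Sum>j<My. ((v (i + 1) (j + 1) - v i (j + 1)) - (v (i + 1) j - v i j))
                   * ((w (i + 1) (j + 1) - w i (j + 1)) - (w (i + 1) j - w i j)))"

text \<open>In one direction the average is the identity plus a twelfth of the second difference. This is
  the form of the product of the two directional averages after summation by parts.\<close>

definition avg_form :: "nat \<Rightarrow> nat \<Rightarrow> gridfun \<Rightarrow> gridfun \<Rightarrow> real" where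
  "avg_form Mx My v w = mass_form Mx My v w - grad_x_form Mx My v w / 12
     - grad_y_form Mx My v w / 12 + grad_xy_form Mx My v w / 144"

lemmas grid_form_defs = mass_form_def grad_x_form_def grad_y_form_def grad_xy_form_def

lemma avg_form_commute: "avg_form Mx My v w = avg_form Mx My w v"
  by (simp add: avg_form_def grid_form_defs mult.commute)

lemma avg_form_diff:
  "avg_form Mx My (\<lambda>i j. u i j - v i j) w = avg_form Mx My u w - avg_form Mx My v w"
proof -
  have "mass_form Mx My (\<lambda>i j. u i j - v i j) w = mass_form Mx My u w - mass_form Mx My v w"
    "grad_x_form Mx My (\<lambda>i j. u i j - v i j) w = grad_x_form Mx My u w - grad_x_form Mx My v w"
    "grad_y_form Mx My (\<lambda>i j. u i j - v i j) w = grad_y_form Mx My u w - grad_y_form Mx My v w"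
    "grad_xy_form Mx My (\<lambda>i j. u i j - v i j) w = grad_xy_form Mx My u w - grad_xy_form Mx My v w"
    unfolding grid_form_defs sum_subtractf[symmetric]
    by (intro sum.cong refl; simp add: algebra_simps)+
  then show ?thesis by (simp add: avg_form_def field_simps)
qed

lemma avg_form_mean:
  "avg_form Mx My u (\<lambda>i j. (v i j + w i j) / 2) = (avg_form Mx My u v + avg_form Mx My u w) / 2"
proof -
  have "mass_form Mx My u (\<lambda>i j. (v i j + w i j) / 2) = (mass_form Mx My u v + mass_form Mx My u w) / 2"
    "grad_x_form Mx My u (\<lambda>i j. (v i j + w i j) / 2) = (grad_x_form Mx My u v + grad_x_form Mx My u w) / 2"
    "grad_y_form Mx My u (\<lambda>i j. (v i j + w i j) / 2) = (grad_y_form Mx My u v + grad_y_form Mx My u w) / 2"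
    "grad_xy_form Mx My u (\<lambda>i j. (v i j + w i j) / 2) = (grad_xy_form Mx My u v + grad_xy_form Mx My u w) / 2"
    unfolding grid_form_defs sum.distrib[symmetric] sum_divide_distrib
    by (intro sum.cong refl; simp add: field_simps)+
  then show ?thesis by (simp add: avg_form_def field_simps)
qed

lemma summation_by_parts:
  fixes v w :: "nat \<Rightarrow> real"
  assumes "w 0 = 0" "w M = 0"
  shows "(\<Sum>i=1..M-1. (v (i + 1) - 2 * v i + v (i - 1)) * w i)
    = - (\<Sum>i<M. (v (i + 1) - v i) * (w (i + 1) - w i))"
proof -
  have *: "(\<Sum>i<Suc m. (v (i + 1) - v i) * (w (i + 1) - w i))
     = (v (m + 1) - v m) * w (m + 1) - (\<Sum>i=1..m. (v (i + 1) - 2 * v i + v (i - 1)) * w i)" for m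
    using assms(1) by (induction m) (auto simp: algebra_simps)
  show ?thesis
  proof (cases M)
    case (Suc m)
    then show ?thesis using *[of m] assms(2) by simp
  qed simp
qed

text \<open>The polarized parallelogram law. It gives the inverse inequality for differences, and it also
  shows that the excess in that inequality is a sum of squares.\<close>

lemma sum_diff_products_eq:
  fixes v w :: "nat \<Rightarrow> real"
  assumes "v 0 = 0" "v M = 0"
  shows "(\<Sum>i<M. (v (i + 1) - v i) * (w (i + 1) - w i))
    = 4 * (\<Sum>i=1..M-1. v i * w i) - (\<Sum>i<M. (v (i + 1) + v i) * (w (i + 1) + w i))"
proof -
  have *: "(\<Sum>i<Suc m. (v (i + 1) - v i) * (w (i + 1) - w i))
      + (\<Sum>i<Suc m. (v (i + 1) + v i) * (w (i + 1) + w i))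
     = 4 * (\<Sum>i=1..m. v i * w i) + 2 * v (m + 1) * w (m + 1)" for m
    using assms(1) by (induction m) (auto simp: algebra_simps)
  show ?thesis
  proof (cases M)
    case (Suc m)
    then show ?thesis using *[of m] assms(2) by simp
  qed simp
qed

text \<open>The form of the directional difference summed over neighbouring lines. It is the excess
  of \<open>4 * grad_x_form\<close> over \<open>grad_xy_form\<close> for functions that vanish on the boundary.\<close>

definition sum_grad_x_form :: "nat \<Rightarrow> nat \<Rightarrow> gridfun \<Rightarrow> gridfun \<Rightarrow> real" where
  "sum_grad_x_form Mx My v w =
     (\<Sum>i<Mx. \<Sum>j<My. ((v (i + 1) (j + 1) - v i (j + 1)) + (v (i + 1) j - v i j))
                   * ((w (i + 1) (j + 1) - w i (j + 1)) + (w (i + 1) j - w i j)))"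

definition sum_grad_y_form :: "nat \<Rightarrow> nat \<Rightarrow> gridfun \<Rightarrow> gridfun \<Rightarrow> real" where
  "sum_grad_y_form Mx My v w =
     (\<Sum>i<Mx. \<Sum>j<My. ((v (i + 1) (j + 1) - v (i + 1) j) + (v i (j + 1) - v i j))
                   * ((w (i + 1) (j + 1) - w (i + 1) j) + (w i (j + 1) - w i j)))"

lemma grad_xy_form_eq_x:
  assumes "vanishes_on_boundary Mx My v"
  shows "grad_xy_form Mx My v w = 4 * grad_x_form Mx My v w - sum_grad_x_form Mx My v w"
  unfolding grad_xy_form_def grad_x_form_def sum_grad_x_form_def
    sum_distrib_left[of 4 _ "{..<Mx}"] sum_subtractf[symmetric, of _ "{..<Mx}"]
  by (rule sum.cong[OF refl], rule sum_diff_products_eq[of "\<lambda>j. v (_ + 1) j - v _ j"])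
     (auto simp: vanishes_on_boundaryD[OF assms])

lemma grad_xy_form_eq_y:
  assumes "vanishes_on_boundary Mx My v"
  shows "grad_xy_form Mx My v w = 4 * grad_y_form Mx My v w - sum_grad_y_form Mx My v w"
proof -
  have "grad_xy_form Mx My v w =
     (\<Sum>j<My. \<Sum>i<Mx. ((v (i + 1) (j + 1) - v (i + 1) j) - (v i (j + 1) - v i j))
                   * ((w (i + 1) (j + 1) - w (i + 1) j) - (w i (j + 1) - w i j)))"
    unfolding grad_xy_form_def by (subst sum.swap) (simp add: algebra_simps)
  moreover have "grad_y_form Mx My v w =
     (\<Sum>j<My. \<Sum>i=1..Mx-1. (v i (j + 1) - v i j) * (w i (j + 1) - w i j))"
    unfolding grad_y_form_def by (rule sum.swap)
  moreover have "sum_grad_y_form Mx My v w =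
     (\<Sum>j<My. \<Sum>i<Mx. ((v (i + 1) (j + 1) - v (i + 1) j) + (v i (j + 1) - v i j))
                   * ((w (i + 1) (j + 1) - w (i + 1) j) + (w i (j + 1) - w i j)))"
    unfolding sum_grad_y_form_def by (rule sum.swap)
  ultimately show ?thesis
    by (simp only: sum_distrib_left[of 4 _ "{..<My}"] sum_subtractf[symmetric, of _ "{..<My}"])
       (rule sum.cong[OF refl], rule sum_diff_products_eq[of "\<lambda>i. v i (_ + 1) - v i _"];
        auto simp: vanishes_on_boundaryD[OF assms])
qed

lemma
  shows grad_x_form_nonneg: "0 \<le> grad_x_form Mx My v v"
    and grad_y_form_nonneg: "0 \<le> grad_y_form Mx My v v"
    and grad_xy_form_nonneg: "0 \<le> grad_xy_form Mx My v v"
    and mass_form_nonneg: "0 \<le> mass_form Mx My v v"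
    and sum_grad_x_form_nonneg: "0 \<le> sum_grad_x_form Mx My v v"
  unfolding grid_form_defs sum_grad_x_form_def by (intro sum_nonneg zero_le_square)+

lemma grad_x_form_le:
  assumes "vanishes_on_boundary Mx My v"
  shows "grad_x_form Mx My v v \<le> 4 * mass_form Mx My v v"
proof -
  have "(\<Sum>i<Mx. (v (i + 1) j - v i j) * (v (i + 1) j - v i j)) \<le> 4 * (\<Sum>i=1..Mx-1. v i j * v i j)"
    if "j \<in> {1..My-1}" for j
  proof -
    have "0 \<le> (\<Sum>i<Mx. (v (i + 1) j + v i j) * (v (i + 1) j + v i j))"
      by (intro sum_nonneg zero_le_square)
    moreover have "j \<le> My" using that by auto
    ultimately show ?thesis
      using sum_diff_products_eq[of "\<lambda>i. v i j" Mx "\<lambda>i. v i j"]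
      by (simp add: vanishes_on_boundaryD[OF assms])
  qed
  then have "(\<Sum>j=1..My-1. \<Sum>i<Mx. (v (i + 1) j - v i j) * (v (i + 1) j - v i j))
     \<le> 4 * (\<Sum>j=1..My-1. \<Sum>i=1..Mx-1. v i j * v i j)"
    unfolding sum_distrib_left[of 4 _ "{1..My-1}"] by (rule sum_mono)
  then show ?thesis
    unfolding grad_x_form_def mass_form_def
    by (subst sum.swap, subst (2) sum.swap)
qed

lemma grad_y_form_le:
  assumes "vanishes_on_boundary Mx My v"
  shows "grad_y_form Mx My v v \<le> 4 * mass_form Mx My v v"
  unfolding grad_y_form_def mass_form_def sum_distrib_left[of 4 _ "{1..Mx-1}"]
proof (rule sum_mono)
  fix i assume "i \<in> {1..Mx-1}"
  have "0 \<le> (\<Sum>j<My. (v i (j + 1) + v i j) * (v i (j + 1) + v i j))"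
    by (intro sum_nonneg zero_le_square)
  moreover have "i \<le> Mx" using \<open>i \<in> _\<close> by auto
  ultimately show "(\<Sum>j<My. (v i (j + 1) - v i j) * (v i (j + 1) - v i j)) \<le> 4 * (\<Sum>j=1..My-1. v i j * v i j)"
    using sum_diff_products_eq[of "v i" My "v i"]
    by (simp add: vanishes_on_boundaryD[OF assms])
qed

text \<open>Differences of grid functions that vanish on the boundary cost at most a factor \<open>4\<close> in squared
  norm. Hence the two single differences in \<open>avg_form\<close> subtract at most a third of the mass each, and
  the mixed one adds at most a third of one of the subtracted terms.\<close>

lemma avg_form_bounds:
  assumes "vanishes_on_boundary Mx My v"
  shows avg_form_ge: "mass_form Mx My v v / 3 \<le> avg_form Mx My v v"
    and avg_form_le: "avg_form Mx My v v \<le> mass_form Mx My v v"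
proof -
  note b = grad_x_form_le[OF assms] grad_y_form_le[OF assms] grad_xy_form_eq_x[OF assms, of v]
    sum_grad_x_form_nonneg[of Mx My v] grad_xy_form_nonneg[of Mx My v]
    grad_x_form_nonneg[of Mx My v] grad_y_form_nonneg[of Mx My v]
  show "mass_form Mx My v v / 3 \<le> avg_form Mx My v v" "avg_form Mx My v v \<le> mass_form Mx My v v"
    unfolding avg_form_def using b by linarith+
qed

lemma avg_form_nonneg: "vanishes_on_boundary Mx My v \<Longrightarrow> 0 \<le> avg_form Mx My v v"
  using avg_form_ge[of Mx My v] mass_form_nonneg[of Mx My v] by simp

lemma vanishes_on_boundary_combine:
  assumes "vanishes_on_boundary Mx My v" "vanishes_on_boundary Mx My w"
  shows "vanishes_on_boundary Mx My (\<lambda>i j. v i j - w i j)"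
    "vanishes_on_boundary Mx My (\<lambda>i j. (v i j + w i j) / 2)"
  using assms by (simp_all add: vanishes_on_boundary_def case_prod_beta)

lemma avg_form_abs_le:
  assumes v: "vanishes_on_boundary Mx My v" and w: "vanishes_on_boundary Mx My w"
  shows "\<bar>avg_form Mx My v w\<bar> \<le> (avg_form Mx My v v + avg_form Mx My w w) / 2"
proof -
  let ?a = "avg_form Mx My"
  have "0 \<le> ?a (\<lambda>i j. v i j - w i j) (\<lambda>i j. v i j - w i j)"
    by (rule avg_form_nonneg[OF vanishes_on_boundary_combine(1)[OF v w]])
  also have "\<dots> = ?a v v - 2 * ?a v w + ?a w w"
    by (simp add: avg_form_diff avg_form_commute[of _ _ _ "\<lambda>i j. v i j - w i j"])
       (simp add: avg_form_commute)
  finally have 1: "0 \<le> ?a v v - 2 * ?a v w + ?a w w" .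
  have "0 \<le> ?a (\<lambda>i j. (v i j + w i j) / 2) (\<lambda>i j. (v i j + w i j) / 2)"
    by (rule avg_form_nonneg[OF vanishes_on_boundary_combine(2)[OF v w]])
  also have "\<dots> = (?a v v + 2 * ?a v w + ?a w w) / 4"
    by (simp add: avg_form_mean avg_form_commute[of _ _ "\<lambda>i j. (v i j + w i j) / 2"])
       (simp add: avg_form_commute[of _ _ w v] field_simps)
  finally show ?thesis using 1 by (simp add: abs_le_iff)
qed

definition second_diff_x :: "gridfun \<Rightarrow> gridfun" where
  "second_diff_x v i j = v (i + 1) j - 2 * v i j + v (i - 1) j"

definition second_diff_y :: "gridfun \<Rightarrow> gridfun" where
  "second_diff_y v i j = v i (j + 1) - 2 * v i j + v i (j - 1)"

lemma mass_form_second_diff_x: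
  assumes "vanishes_on_boundary Mx My w"
  shows "mass_form Mx My (second_diff_x v) w = - grad_x_form Mx My v w"
proof -
  have "mass_form Mx My (second_diff_x v) w
     = (\<Sum>j=1..My-1. \<Sum>i=1..Mx-1. (v (i + 1) j - 2 * v i j + v (i - 1) j) * w i j)"
    unfolding mass_form_def second_diff_x_def by (rule sum.swap)
  also have "\<dots> = (\<Sum>j=1..My-1. - (\<Sum>i<Mx. (v (i + 1) j - v i j) * (w (i + 1) j - w i j)))"
    by (rule sum.cong[OF refl], rule summation_by_parts[of "\<lambda>i. w i _"])
       (auto simp: vanishes_on_boundaryD[OF assms])
  also have "\<dots> = - grad_x_form Mx My v w"
    unfolding grad_x_form_def sum_negf by (subst sum.swap) (rule refl)
  finally show ?thesis .
qed

lemma mass_form_second_diff_y: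
  assumes "vanishes_on_boundary Mx My w"
  shows "mass_form Mx My (second_diff_y v) w = - grad_y_form Mx My v w"
  unfolding mass_form_def second_diff_y_def grad_y_form_def sum_negf[symmetric, of _ "{1..Mx-1}"]
  by (rule sum.cong[OF refl], rule summation_by_parts[of "w _"])
     (auto simp: vanishes_on_boundaryD[OF assms])

lemma mass_form_second_diff_xy:
  assumes "vanishes_on_boundary Mx My w"
  shows "mass_form Mx My (second_diff_x (second_diff_y v)) w = grad_xy_form Mx My v w"
proof -
  have "- grad_x_form Mx My (second_diff_y v) w = grad_xy_form Mx My v w"
    unfolding grad_x_form_def grad_xy_form_def sum_negf[symmetric, of _ "{..<Mx}"]
  proof (intro sum.cong refl)
    fix i assume "i \<in> {..<Mx}"
    then have "(\<Sum>j=1..My-1. ((v (i+1) (j+1) - v i (j+1)) - 2 * (v (i+1) j - v i j)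
          + (v (i+1) (j-1) - v i (j-1))) * (w (i+1) j - w i j))
       = - (\<Sum>j<My. ((v (i + 1) (j + 1) - v i (j + 1)) - (v (i + 1) j - v i j))
                   * ((w (i + 1) (j + 1) - w i (j + 1)) - (w (i + 1) j - w i j)))"
      by (intro summation_by_parts[of "\<lambda>j. w (i + 1) j - w i j" My "\<lambda>j. v (i + 1) j - v i j"])
         (simp_all add: vanishes_on_boundaryD[OF assms])
    moreover have "(\<Sum>j=1..My-1. (second_diff_y v (i + 1) j - second_diff_y v i j) * (w (i+1) j - w i j))
      = (\<Sum>j=1..My-1. ((v (i+1) (j+1) - v i (j+1)) - 2 * (v (i+1) j - v i j)
          + (v (i+1) (j-1) - v i (j-1))) * (w (i+1) j - w i j))"
      by (intro sum.cong refl) (simp add: second_diff_y_def)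
    ultimately show "- (\<Sum>j=1..My-1. (second_diff_y v (i + 1) j - second_diff_y v i j) * (w (i+1) j - w i j))
       = (\<Sum>j<My. ((v (i + 1) (j + 1) - v i (j + 1)) - (v (i + 1) j - v i j))
                   * ((w (i + 1) (j + 1) - w i (j + 1)) - (w (i + 1) j - w i j)))"
      by simp
  qed
  with mass_form_second_diff_x[OF assms, of "second_diff_y v"] show ?thesis by (rule trans)
qed

text \<open>The average is expanded into second differences, and summation by parts moves each of them
  onto first differences; the boundary terms vanish together with \<open>w\<close>.\<close>

lemma mass_form_avg:
  assumes "vanishes_on_boundary Mx My w"
  shows "mass_form Mx My (avg Mx My v) w = avg_form Mx My v w"
proof -
  have "avg Mx My v i j = v i j + second_diff_x v i j / 12 + second_diff_y v i j / 12
       + second_diff_x (second_diff_y v) i j / 144"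
    if "i \<in> {1..Mx-1}" "j \<in> {1..My-1}" for i j
    using that by (simp add: avg_def avg_x_def avg_y_def second_diff_x_def second_diff_y_def field_simps)
  then have "mass_form Mx My (avg Mx My v) w = (\<Sum>i=1..Mx-1. \<Sum>j=1..My-1.
      v i j * w i j + second_diff_x v i j * w i j / 12 + second_diff_y v i j * w i j / 12
       + second_diff_x (second_diff_y v) i j * w i j / 144)"
    unfolding mass_form_def by (intro sum.cong refl) (simp add: field_simps)
  also have "\<dots> = mass_form Mx My v w + mass_form Mx My (second_diff_x v) w / 12
      + mass_form Mx My (second_diff_y v) w / 12 + mass_form Mx My (second_diff_x (second_diff_y v)) w / 144"
    unfolding mass_form_def by (simp only: sum.distrib sum_divide_distrib)
  also have "\<dots> = avg_form Mx My v w"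
    by (simp add: mass_form_second_diff_x[OF assms, of v] mass_form_second_diff_y[OF assms]
        mass_form_second_diff_xy[OF assms] avg_form_def)
  finally show ?thesis .
qed

text \<open>The mixed difference enters with the wrong sign. Absorbing it into the directional
  differences leaves a combination of squares with positive coefficients, and thus a Gram form.\<close>

lemma mass_form_compact_laplace:
  assumes v: "vanishes_on_boundary Mx My v" and w: "vanishes_on_boundary Mx My w"
  shows "mass_form Mx My (compact_laplace hx hy Mx My v) w
    = - ((2 / 3 * grad_x_form Mx My v w + sum_grad_x_form Mx My v w / 12) / hx\<^sup>2
        + (2 / 3 * grad_y_form Mx My v w + sum_grad_y_form Mx My v w / 12) / hy\<^sup>2)"
proof -
  let ?xy = "second_diff_x (second_diff_y v)"
  have "compact_laplace hx hy Mx My v i j = (second_diff_x v i j + ?xy i j / 12) / hx\<^sup>2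
       + (second_diff_y v i j + ?xy i j / 12) / hy\<^sup>2"
    if "i \<in> {1..Mx-1}" "j \<in> {1..My-1}" for i j
  proof -
    have "avg_y My (diff2_x hx v) i j = (second_diff_x v i j + ?xy i j / 12) / hx\<^sup>2"
      using that by (simp add: avg_y_def diff2_x_def second_diff_x_def second_diff_y_def
          add_divide_distrib diff_divide_distrib)
    moreover have "avg_x Mx (diff2_y hy v) i j = (second_diff_y v i j + ?xy i j / 12) / hy\<^sup>2"
      using that by (simp add: avg_x_def diff2_y_def second_diff_x_def second_diff_y_def
          add_divide_distrib diff_divide_distrib)
    ultimately show ?thesis by (simp add: compact_laplace_def)
  qed
  then have "mass_form Mx My (compact_laplace hx hy Mx My v) w = (\<Sum>i=1..Mx-1. \<Sum>j=1..My-1.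
      (second_diff_x v i j * w i j + ?xy i j * w i j / 12) / hx\<^sup>2
       + (second_diff_y v i j * w i j + ?xy i j * w i j / 12) / hy\<^sup>2)"
    unfolding mass_form_def by (intro sum.cong refl) (simp add: algebra_simps add_divide_distrib)
  also have "\<dots> = (mass_form Mx My (second_diff_x v) w + mass_form Mx My ?xy w / 12) / hx\<^sup>2
      + (mass_form Mx My (second_diff_y v) w + mass_form Mx My ?xy w / 12) / hy\<^sup>2"
    unfolding mass_form_def by (simp only: sum.distrib sum_divide_distrib add_divide_distrib)
  also have "\<dots> = - ((grad_x_form Mx My v w - grad_xy_form Mx My v w / 12) / hx\<^sup>2
      + (grad_y_form Mx My v w - grad_xy_form Mx My v w / 12) / hy\<^sup>2)"
    by (simp add: mass_form_second_diff_x[OF w, of v] mass_form_second_diff_y[OF w]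
        mass_form_second_diff_xy[OF w] diff_divide_distrib add_divide_distrib)
  also have "grad_x_form Mx My v w - grad_xy_form Mx My v w / 12
      = 2 / 3 * grad_x_form Mx My v w + sum_grad_x_form Mx My v w / 12"
    unfolding grad_xy_form_eq_x[OF v] by (simp add: field_simps)
  also have "grad_y_form Mx My v w - grad_xy_form Mx My v w / 12
      = 2 / 3 * grad_y_form Mx My v w + sum_grad_y_form Mx My v w / 12"
    unfolding grad_xy_form_eq_y[OF v] by (simp add: field_simps)
  finally show ?thesis .
qed

text \<open>The property of the weights \<open>c\<close> that the diffusion term needs, as a predicate on the Gram matrix
  \<open>G\<close>: in this form it passes from products of scalars to sums of such products.\<close>

definition psd_pairing :: "(nat \<Rightarrow> nat \<Rightarrow> real) \<Rightarrow> nat \<Rightarrow> (nat \<Rightarrow> nat \<Rightarrow> real) \<Rightarrow> bool" where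
  "psd_pairing c m G \<longleftrightarrow> 0 \<le> (\<Sum>n=1..m. \<Sum>j=1..n. c n j * G j n)"

lemma psd_pairing_sum:
  assumes "\<And>p. p \<in> P \<Longrightarrow> psd_pairing c m (\<lambda>j n. G p j n)"
  shows "psd_pairing c m (\<lambda>j n. \<Sum>p\<in>P. G p j n)"
proof -
  have "(\<Sum>n=1..m. \<Sum>j=1..n. c n j * (\<Sum>p\<in>P. G p j n))
      = (\<Sum>p\<in>P. \<Sum>n=1..m. \<Sum>j=1..n. c n j * G p j n)"
    by (simp only: sum_distrib_left sum.swap[of _ P])
  then show ?thesis using assms by (simp add: psd_pairing_def sum_nonneg)
qed

lemma psd_pairing_cone:
  assumes "psd_pairing c m G" "psd_pairing c m G'" "0 \<le> a" "0 \<le> b"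
  shows "psd_pairing c m (\<lambda>j n. a * G j n + b * G' j n)"
proof -
  have "(\<Sum>n=1..m. \<Sum>j=1..n. c n j * (a * G j n + b * G' j n))
      = a * (\<Sum>n=1..m. \<Sum>j=1..n. c n j * G j n) + b * (\<Sum>n=1..m. \<Sum>j=1..n. c n j * G' j n)"
    unfolding sum_distrib_left sum.distrib[symmetric]
    by (intro sum.cong refl) (simp add: algebra_simps)
  then show ?thesis using assms by (simp add: psd_pairing_def)
qed

lemma compact_laplace_psd:
  assumes psd: "\<And>x. psd_pairing c m (\<lambda>j n. x j * x n)"
    and V: "\<And>n. 1 \<le> n \<Longrightarrow> n \<le> m \<Longrightarrow> vanishes_on_boundary Mx My (V n)"
  shows "0 \<le> (\<Sum>n=1..m. \<Sum>j=1..n. c n j * - mass_form Mx My (compact_laplace hx hy Mx My (V j)) (V n))"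
proof -
  let ?x = "\<lambda>j n. 2 / 3 * grad_x_form Mx My (V j) (V n) + 1 / 12 * sum_grad_x_form Mx My (V j) (V n)"
  let ?y = "\<lambda>j n. 2 / 3 * grad_y_form Mx My (V j) (V n) + 1 / 12 * sum_grad_y_form Mx My (V j) (V n)"
  have "psd_pairing c m (\<lambda>j n. 1 / hx\<^sup>2 * ?x j n + 1 / hy\<^sup>2 * ?y j n)"
    unfolding grad_x_form_def grad_y_form_def sum_grad_x_form_def sum_grad_y_form_def
    by (intro psd_pairing_cone psd_pairing_sum psd) auto
  also have "psd_pairing c m (\<lambda>j n. 1 / hx\<^sup>2 * ?x j n + 1 / hy\<^sup>2 * ?y j n) \<longleftrightarrow>
     0 \<le> (\<Sum>n=1..m. \<Sum>j=1..n. c n j * - mass_form Mx My (compact_laplace hx hy Mx My (V j)) (V n))"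
    unfolding psd_pairing_def
    by (intro arg_cong[of _ _ "\<lambda>x. 0 \<le> x"] sum.cong refl)
       (simp add: mass_form_compact_laplace V)
  finally show ?thesis .
qed

text \<open>The nine weights of the compact average sum to one.\<close>

lemma avg_shift_const:
  assumes "(i, j) \<in> interior_idx Mx My"
  shows "avg Mx My v i j = c + avg Mx My (\<lambda>i j. v i j - c) i j"
  using assms by (simp add: interior_idx_def avg_def avg_x_def avg_y_def field_simps)

lemma grid_norm_square:
  assumes "0 \<le> hx * hy"
  shows "(grid_norm hx hy Mx My v)\<^sup>2 = hx * hy * mass_form Mx My v v"
proof -
  have "(\<Sum>(i, j)\<in>interior_idx Mx My. (v i j)\<^sup>2) = mass_form Mx My v v"
    by (simp add: mass_form_def interior_idx_def sum.cartesian_product power2_eq_square)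
  then show ?thesis
    using assms mass_form_nonneg[of Mx My v] by (simp add: grid_norm_def)
qed

section \<open>Stability of the scheme\<close>

lemma mass_form_cong:
  assumes "\<And>i j. (i, j) \<in> interior_idx Mx My \<Longrightarrow> v i j = v' i j"
  shows "mass_form Mx My v w = mass_form Mx My v' w"
  unfolding mass_form_def using assms by (intro sum.cong refl) (auto simp: interior_idx_def)

lemma mass_form_linear:
  "mass_form Mx My (\<lambda>i j. u i j + v i j) w = mass_form Mx My u w + mass_form Mx My v w"
  "mass_form Mx My (\<lambda>i j. u i j - v i j) w = mass_form Mx My u w - mass_form Mx My v w"
  "mass_form Mx My (\<lambda>i j. c * u i j) w = c * mass_form Mx My u w"
  "mass_form Mx My (\<lambda>i j. \<Sum>k\<in>K. s k i j) w = (\<Sum>k\<in>K. mass_form Mx My (s k) w)"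
proof -
  show "mass_form Mx My (\<lambda>i j. u i j + v i j) w = mass_form Mx My u w + mass_form Mx My v w"
    "mass_form Mx My (\<lambda>i j. u i j - v i j) w = mass_form Mx My u w - mass_form Mx My v w"
    "mass_form Mx My (\<lambda>i j. c * u i j) w = c * mass_form Mx My u w"
    by (simp_all add: mass_form_def distrib_right left_diff_distrib sum.distrib sum_subtractf
        sum_distrib_left mult.assoc)
  show "mass_form Mx My (\<lambda>i j. \<Sum>k\<in>K. s k i j) w = (\<Sum>k\<in>K. mass_form Mx My (s k) w)"
    unfolding mass_form_def sum_distrib_right by (simp only: sum.swap[of _ K])
qed

lemma mass_form_mono:
  assumes "\<And>i j. (i, j) \<in> interior_idx Mx My \<Longrightarrow> (v i j)\<^sup>2 \<le> (w i j)\<^sup>2"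
  shows "mass_form Mx My v v \<le> mass_form Mx My w w"
  unfolding mass_form_def using assms
  by (intro sum_mono) (auto simp: interior_idx_def power2_eq_square)

lemma mass_form_abs_le:
  "\<bar>mass_form Mx My v w\<bar> \<le> (mass_form Mx My v v + mass_form Mx My w w) / 2"
proof -
  have "\<bar>v i j * w i j\<bar> \<le> (v i j * v i j + w i j * w i j) / 2" for i j
    using sum_squares_bound[of "\<bar>v i j\<bar>" "\<bar>w i j\<bar>"] by (simp add: power2_eq_square abs_mult)
  then have "\<bar>mass_form Mx My v w\<bar> \<le> (\<Sum>i=1..Mx-1. \<Sum>j=1..My-1. (v i j * v i j + w i j * w i j) / 2)"
    unfolding mass_form_def by (intro order.trans[OF sum_abs] sum_mono)
  also have "\<dots> = (mass_form Mx My v v + mass_form Mx My w w) / 2"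
    unfolding mass_form_def by (simp only: sum.distrib sum_divide_distrib[symmetric])
  finally show ?thesis .
qed

lemma avg_tdiff: "avg Mx My (tdiff \<tau> U n) i j = (avg Mx My (U n) i j - avg Mx My (U (n - 1)) i j) / \<tau>"
  by (simp add: avg_def avg_x_def avg_y_def tdiff_def diff_divide_distrib add_divide_distrib)

lemma compact_laplace_mean:
  "compact_laplace hx hy Mx My (\<lambda>i j. (v i j + w i j) / 2) i j
    = (compact_laplace hx hy Mx My v i j + compact_laplace hx hy Mx My w i j) / 2"
proof -
  have "diff2_x hx (\<lambda>i j. (v i j + w i j) / 2) i j = (diff2_x hx v i j + diff2_x hx w i j) / 2"
    "diff2_y hy (\<lambda>i j. (v i j + w i j) / 2) i j = (diff2_y hy v i j + diff2_y hy w i j) / 2" for i j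
    by (simp_all add: diff2_x_def diff2_y_def add_divide_distrib diff_divide_distrib algebra_simps)
  then show ?thesis
    by (simp add: compact_laplace_def avg_x_def avg_y_def add_divide_distrib)
qed

text \<open>The first step of the scheme uses the new value in place of a mean value, and so does the test
  function: then the same grid functions occur on both sides of the diffusion term.\<close>

definition test_function :: "(nat \<Rightarrow> gridfun) \<Rightarrow> nat \<Rightarrow> gridfun" where
  "test_function U n = (if n = 1 then U 1 else (\<lambda>i j. (U n i j + U (n - 1) i j) / 2))"

lemma frac_quad_eq:
  assumes "2 \<le> n"
  shows "frac_quad a \<tau> n (\<lambda>m. compact_laplace hx hy Mx My (U m) i j)
    = (\<Sum>k=1..n. quad_wt a \<tau> n k * compact_laplace hx hy Mx My (test_function U k) i j)"
proof -
  have "(\<Sum>k=1..n. quad_wt a \<tau> n k * compact_laplace hx hy Mx My (test_function U k) i j)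
     = quad_wt a \<tau> n 1 * compact_laplace hx hy Mx My (test_function U 1) i j
     + (\<Sum>k=2..n. quad_wt a \<tau> n k * compact_laplace hx hy Mx My (test_function U k) i j)"
    using assms by (subst sum.atLeast_Suc_atMost) (auto simp: numeral_2_eq_2)
  also have "(\<Sum>k=2..n. quad_wt a \<tau> n k * compact_laplace hx hy Mx My (test_function U k) i j)
     = (\<Sum>k=2..n. quad_wt a \<tau> n k * half_avg (\<lambda>m. compact_laplace hx hy Mx My (U m) i j) k)"
    by (intro sum.cong refl) (simp add: test_function_def half_avg_def compact_laplace_mean)
  finally show ?thesis by (simp add: frac_quad_def test_function_def)
qed

text \<open>The weights of \<open>f (U k)\<close>, in a form that also covers the first step. The full weight at \<open>n = 1\<close> is
  not an instance of the half weight at later diagonals.\<close>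

definition source_wt :: "real \<Rightarrow> real \<Rightarrow> nat \<Rightarrow> nat \<Rightarrow> real" where
  "source_wt a \<tau> n k =
     (if k < n then quad_wt_avg a \<tau> n k else if n = 1 then quad_wt a \<tau> 1 1 else quad_wt a \<tau> n n / 2)"

text \<open>Each source weight is at most the sum of two neighbouring quadrature weights, so the row sum is at
  most twice \<open>T\<^sup>a / \<Gamma>(1 + a)\<close>.\<close>

lemma source_wt_bounds:
  assumes "0 < a" "a < 1" "0 < \<tau>" "1 \<le> n" "\<tau> * real n \<le> T"
  shows source_wt_nonneg: "k \<in> {1..n} \<Longrightarrow> 0 \<le> source_wt a \<tau> n k"
    and source_wt_sum: "(\<Sum>k=1..n. source_wt a \<tau> n k) \<le> 2 * (T powr a / Gamma (1 + a))"
proof -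
  have q: "0 \<le> quad_wt a \<tau> n k" if "1 \<le> k" "k \<le> n" for k
    using quad_wt_nonneg assms that by simp
  show "0 \<le> source_wt a \<tau> n k" if k: "k \<in> {1..n}"
    using q[of k] q[of "k + 1"] q[of 2] that
    by (auto simp: source_wt_def quad_wt_avg_def numeral_2_eq_2)
  have "(\<Sum>k=1..n. source_wt a \<tau> n k) = source_wt a \<tau> n n + (\<Sum>k=1..n-1. source_wt a \<tau> n k)"
    using \<open>1 \<le> n\<close> by (cases n) auto
  also have "\<dots> \<le> quad_wt a \<tau> n n + (\<Sum>k=1..n-1. quad_wt a \<tau> n k + quad_wt a \<tau> n (k + 1))"
  proof (intro add_mono sum_mono)
    show "source_wt a \<tau> n n \<le> quad_wt a \<tau> n n" using q[of n] \<open>1 \<le> n\<close> by (simp add: source_wt_def)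
    fix k assume "k \<in> {1..n-1}"
    then show "source_wt a \<tau> n k \<le> quad_wt a \<tau> n k + quad_wt a \<tau> n (k + 1)"
      using q[of k] q[of "k + 1"] by (auto simp: source_wt_def quad_wt_avg_def numeral_2_eq_2)
  qed
  also have "\<dots> = (\<Sum>k=1..n. quad_wt a \<tau> n k) + (\<Sum>k=2..n. quad_wt a \<tau> n k)"
  proof -
    have "(\<Sum>k=1..n-1. quad_wt a \<tau> n (k + 1)) = (\<Sum>k=2..n. quad_wt a \<tau> n k)"
      by (rule sum.reindex_bij_witness[of _ "\<lambda>k. k - 1" "\<lambda>k. k + 1"]) auto
    moreover have "(\<Sum>k=1..n. quad_wt a \<tau> n k) = (\<Sum>k=1..n-1. quad_wt a \<tau> n k) + quad_wt a \<tau> n n"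
      using \<open>1 \<le> n\<close> by (cases n) auto
    ultimately show ?thesis by (simp add: sum.distrib)
  qed
  also have "(\<Sum>k=2..n. quad_wt a \<tau> n k) \<le> (\<Sum>k=1..n. quad_wt a \<tau> n k)"
    by (rule sum_mono2) (use q in auto)
  also have "(\<Sum>k=1..n. quad_wt a \<tau> n k) \<le> T powr a / Gamma (1 + a)"
  proof (rule order.trans[OF sum_quad_wt_le])
    show "(\<tau> * real n) powr a / Gamma (1 + a) \<le> T powr a / Gamma (1 + a)"
      using assms by (intro divide_right_mono powr_mono2) (auto intro: less_imp_le)
  qed (use assms in auto)
  finally show "(\<Sum>k=1..n. source_wt a \<tau> n k) \<le> 2 * (T powr a / Gamma (1 + a))" by simp
qed

lemma C2_bounded_deriv_lipschitz:
  assumes "C2_bounded_deriv Q f"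
  shows "\<bar>f x - f 0\<bar> \<le> Q * \<bar>x\<bar>"
proof -
  obtain f1 where "\<And>x. (f has_real_derivative f1 x) (at x)" "\<And>x. \<bar>f1 x\<bar> \<le> Q"
    using assms by (auto simp: C2_bounded_deriv_def)
  then show ?thesis
    using field_differentiable_bound[of UNIV f f1 Q x 0] by simp
qed

lemma b_term_eq:
  assumes g: "g_bounds T Q g" and \<tau>: "0 < \<tau>" "\<tau> * real N \<le> T" and n: "1 \<le> n" "n \<le> N"
  obtains c where "\<bar>c\<bar> \<le> Q" "b_term \<tau> g v n = (\<lambda>i j. c * v i j)"
proof -
  let ?I = "{tnode \<tau> (n - 1)..tnode \<tau> n}"
  have len: "tnode \<tau> n = tnode \<tau> (n - 1) + \<tau>" using n by (simp add: tnode_def of_nat_diff algebra_simps)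
  have sub: "?I \<subseteq> {0..T}"
  proof -
    have "0 \<le> tnode \<tau> (n - 1)" using \<tau> by (simp add: tnode_def)
    then show ?thesis using tnode_le[OF \<tau> n(2)] by auto
  qed
  obtain g1 where g1: "\<And>t. t \<in> {0..T} \<Longrightarrow> (g has_real_derivative g1 t) (at t within {0..T})"
      and b: "\<And>t. t \<in> {0..T} \<Longrightarrow> \<bar>g t\<bar> \<le> Q"
    using g unfolding g_bounds_def by blast
  have cont: "continuous_on {0..T} g" by (rule DERIV_continuous_on[OF g1])
  have "norm (integral ?I g) \<le> Q * (tnode \<tau> n - tnode \<tau> (n - 1))"
  proof (intro integral_bound)
    show "tnode \<tau> (n - 1) \<le> tnode \<tau> n" using len \<tau> by simp
    show "continuous_on ?I g" using cont sub by (rule continuous_on_subset)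
    show "norm (g t) \<le> Q" if "t \<in> ?I" for t
      unfolding real_norm_def using that sub by (intro b) blast
  qed
  then have "\<bar>1 / \<tau> * integral ?I g\<bar> \<le> Q"
    using \<tau> len by (simp add: abs_mult field_simps)
  moreover have "b_term \<tau> g v n = (\<lambda>i j. 1 / \<tau> * integral ?I g * v i j)"
    by (simp add: b_term_def fun_eq_iff)
  ultimately show thesis by (rule that)
qed

text \<open>\<open>7 + 3 * Qf\<^sup>2\<close> comes from one nonlinear source value and is multiplied by the row sum of the source
  weights; \<open>Qg\<^sup>2 + 3\<close> comes from the initial velocity.\<close>

definition source_const :: "real \<Rightarrow> real \<Rightarrow> real \<Rightarrow> real \<Rightarrow> real" where
  "source_const T a Qg Qf = 2 * (T powr a / Gamma (1 + a)) * (7 + 3 * Qf\<^sup>2) + (Qg\<^sup>2 + 3)"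

text \<open>The rate in the Gronwall inequality. The leading term yields \<open>c\<^sub>0 / 2\<close> times the increment of the
  energy with \<open>c\<^sub>0 \<ge> 1 / 2\<close>, hence the factor \<open>4\<close>; the memory products are at most \<open>3 / 2\<close> times the
  running maximum, hence \<open>6 = 4 * 3 / 2\<close>.\<close>

definition growth_const :: "real \<Rightarrow> real \<Rightarrow> real \<Rightarrow> real \<Rightarrow> real" where
  "growth_const T a Qg Qf = 6 * (Qg * (2 + log_primitive T T)) + 4 * source_const T a Qg Qf"

lemma boundary_node_in_frontier:
  assumes "lx < rx" "ly < ry" "1 \<le> Mx" "1 \<le> My" "(i, j) \<in> boundary_idx Mx My"
  shows "(node lx rx Mx i, node ly ry My j) \<in> frontier (rect lx rx ly ry)"
proof -
  have *: "l \<le> node l r M k \<and> node l r M k \<le> r \<and> (k = 0 \<longrightarrow> node l r M k = l) \<and> (k = M \<longrightarrow> node l r M k = r)"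
    if "l < r" "1 \<le> M" "k \<le> M" for l r :: real and M k
  proof -
    have "real k * ((r - l) / real M) \<le> real M * ((r - l) / real M)"
      using that by (intro mult_right_mono) auto
    then show ?thesis using that by (auto simp: node_def mesh_size_def)
  qed
  have "open (rect lx rx ly ry)" by (simp add: rect_def open_Times)
  moreover have "closure (rect lx rx ly ry) = {lx..rx} \<times> {ly..ry}"
    using assms by (simp add: rect_def closure_Times)
  ultimately have "frontier (rect lx rx ly ry) = {lx..rx} \<times> {ly..ry} - {lx<..<rx} \<times> {ly<..<ry}"
    by (simp add: frontier_def interior_open rect_def)
  moreover have "i \<le> Mx" "j \<le> My" "i = 0 \<or> i = Mx \<or> j = 0 \<or> j = My"
    using assms by (auto simp: boundary_idx_def all_idx_def interior_idx_def)
  ultimately show ?thesis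
    using *[of lx rx Mx i] *[of ly ry My j] assms by auto
qed

text \<open>The scalar energy inequality is applied to \<open>e n = h (A U n, U n)\<close>, where \<open>h\<close> is the area of a mesh
  cell. All products with the test function are split by Young's inequality, in the form of \<open>A\<close> or
  in the mass form.\<close>

lemma scheme_stability:
  fixes lx rx ly ry T :: real and Mx My N :: nat and U :: "nat \<Rightarrow> gridfun"
  defines "hx \<equiv> mesh_size lx rx Mx" and "hy \<equiv> mesh_size ly ry My" and "\<tau> \<equiv> T / real N"
  assumes T: "0 < T" and a: "0 < a" "a < 1" "\<alpha> 0 - 1 = a"
    and dom: "lx < rx" "ly < ry" and M: "1 \<le> Mx" "1 \<le> My" and N: "1 \<le> N"
    and g: "g_bounds T Qg (g_fun \<alpha>)" and f: "C2_bounded_deriv Qf f"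
    and bdry: "\<forall>p\<in>frontier (rect lx rx ly ry). u0 p = 0 \<and> ubar0 p = 0"
    and small: "\<tau> * growth_const T a Qg Qf \<le> 1 / 2" "Qg * \<tau> \<le> 1"
    and sol: "scheme_solution lx rx ly ry T \<alpha> f u0 ubar0 Mx My N U"
    and m: "m \<le> N"
  shows "(grid_norm hx hy Mx My (U m))\<^sup>2 \<le> 6 * exp (2 * T * growth_const T a Qg Qf) *
    ((grid_norm hx hy Mx My (grid_eval lx rx ly ry Mx My u0))\<^sup>2
     + (grid_norm hx hy Mx My (grid_eval lx rx ly ry Mx My (f \<circ> u0)))\<^sup>2
     + (grid_norm hx hy Mx My (grid_eval lx rx ly ry Mx My ubar0))\<^sup>2)"
proof -
  let ?A = "avg Mx My" and ?L = "compact_laplace hx hy Mx My" and ?g = "g_fun \<alpha>"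
  let ?m = "mass_form Mx My" and ?a = "avg_form Mx My"
  let ?E = "grid_eval lx rx ly ry Mx My"
  let ?b = "b_term \<tau> ?g (?E ubar0)" and ?F = "\<lambda>n i j. f (U n i j)"
  let ?I = "interior_idx Mx My"
  define V where "V = test_function U"
  define h where "h = hx * hy"
  have h: "0 < h" using dom M by (simp add: h_def hx_def hy_def mesh_size_def)
  have \<tau>: "0 < \<tau>" "\<tau> * real N \<le> T" using T N by (auto simp: \<tau>_def)
  have norm2: "(grid_norm hx hy Mx My v)\<^sup>2 = h * ?m v v" for v
    using grid_norm_square h by (simp add: h_def)
  define D where "D = h * ?m (?E u0) (?E u0) + h * ?m (?E (f \<circ> u0)) (?E (f \<circ> u0)) + h * ?m (?E ubar0) (?E ubar0)"
  have hm: "0 \<le> h * ?m v v" for v using h mass_form_nonneg by simp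
  have D: "0 \<le> D" "h * ?m (?E ubar0) (?E ubar0) \<le> D" "h * ?m (?E u0) (?E u0) \<le> D"
    using hm[of "?E u0"] hm[of "?E (f \<circ> u0)"] hm[of "?E ubar0"] by (auto simp: D_def)

  note sol' = sol[unfolded scheme_solution_def Let_def, folded hx_def hy_def \<tau>_def, unfolded a(3)]
  have U0: "U 0 i j = ?E u0 i j" if "(i, j) \<in> ?I" for i j using sol' that by blast
  have Ubd: "vanishes_on_boundary Mx My (U n)" if "n \<le> N" for n
    using sol' that by (auto simp: vanishes_on_boundary_def)
  have Vbd: "vanishes_on_boundary Mx My (V n)" if "1 \<le> n" "n \<le> N" for n
    using Ubd[of n] Ubd[of "n - 1"] that
    by (auto simp: V_def test_function_def vanishes_on_boundary_combine)
  have bbd: "vanishes_on_boundary Mx My (\<lambda>i j. c * ?E ubar0 i j)" for c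
    using boundary_node_in_frontier[OF dom M] bdry
    by (auto simp: vanishes_on_boundary_def grid_eval_def)

  have scheme: "?A (tdiff \<tau> U n) i j * c0_coeff \<tau> ?g
      + (\<Sum>k=1..n-1. w_avg \<tau> ?g (n - k) * ?A (tdiff \<tau> U k) i j)
      - (\<Sum>k=1..n. quad_wt a \<tau> n k * ?L (V k) i j)
      = (\<Sum>k=1..n. source_wt a \<tau> n k * ?A (?F k) i j) + ?A (?b n) i j"
    if n: "1 \<le> n" "n \<le> N" and ij: "(i, j) \<in> ?I" for n i j
  proof (cases "n = 1")
    case True
    then show ?thesis using sol' ij by (auto simp: V_def test_function_def source_wt_def mult.commute)
  next
    case False
    then have n2: "n \<in> {2..N}" using n by auto
    have "(\<Sum>k=1..n. source_wt a \<tau> n k * ?A (?F k) i j)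
        = source_wt a \<tau> n n * ?A (?F n) i j + (\<Sum>k=1..n-1. source_wt a \<tau> n k * ?A (?F k) i j)"
      using n by (cases n) auto
    also have "(\<Sum>k=1..n-1. source_wt a \<tau> n k * ?A (?F k) i j)
        = (\<Sum>k=1..n-1. quad_wt_avg a \<tau> n k * ?A (?F k) i j)"
      by (intro sum.cong refl) (auto simp: source_wt_def)
    finally have "(\<Sum>k=1..n. source_wt a \<tau> n k * ?A (?F k) i j)
        = quad_wt a \<tau> n n / 2 * ?A (?F n) i j + (\<Sum>k=1..n-1. quad_wt_avg a \<tau> n k * ?A (?F k) i j)"
      using False by (simp add: source_wt_def)
    moreover have "c0_coeff \<tau> ?g * ?A (tdiff \<tau> U n) i j
         + (\<Sum>k = 1..n - 1. w_avg \<tau> ?g (n - k) * ?A (tdiff \<tau> U k) i j)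
         - frac_quad a \<tau> n (\<lambda>m. ?L (U m) i j)
         = quad_wt a \<tau> n n / 2 * ?A (?F n) i j
         + (\<Sum>k = 1..n - 1. quad_wt_avg a \<tau> n k * ?A (?F k) i j)
         + ?A (?b n) i j"
      using sol' n2 ij by blast
    ultimately show ?thesis
      using n2 by (simp add: frac_quad_eq V_def mult.commute)
  qed

  define e where "e n = h * ?a (U n) (U n)" for n
  define p where "p k n = h * ?a (U k) (V n)" for k n
  define P where "P n = (\<Sum>j=1..n. quad_wt a \<tau> n j * - ?m (?L (V j)) (V n)) * h" for n
  define R where "R n = (\<Sum>k=1..n. source_wt a \<tau> n k * (h * ?m (?A (?F k)) (V n))) + h * ?m (?A (?b n)) (V n)" for n
  have e0: "0 \<le> e n" if "n \<le> N" for n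
    using avg_form_nonneg[OF Ubd[OF that]] h by (simp add: e_def)
  have Ue: "h * ?m (U n) (U n) \<le> 3 * e n" if "n \<le> N" for n
    using avg_form_ge[OF Ubd[OF that]] mult_left_mono[of "?m (U n) (U n)" "3 * ?a (U n) (U n)" h] h
    by (simp add: e_def)
  have half: "\<bar>h * ?a v w\<bar> \<le> (h * ?a v v + h * ?a w w) / 2"
    if "vanishes_on_boundary Mx My v" "vanishes_on_boundary Mx My w" for v w
    using mult_left_mono[OF avg_form_abs_le[OF that], of h] h by (simp add: abs_mult distrib_left)
  have Ve: "h * ?a (V n) (V n) \<le> e n + e (n - 1)" if n: "1 \<le> n" "n \<le> N" for n
  proof (cases "n = 1")
    case True
    then show ?thesis using e0[of 0] by (simp add: V_def test_function_def e_def)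
  next
    case False
    have "?a (V n) (V n) = (?a (U n) (U n) + 2 * ?a (U n) (U (n - 1)) + ?a (U (n - 1)) (U (n - 1))) / 4"
      using False
      by (simp add: V_def test_function_def avg_form_mean
          avg_form_commute[of _ _ "\<lambda>i j. (U n i j + U (n - Suc 0) i j) / 2"])
         (simp add: avg_form_commute[of _ _ "U (n - Suc 0)" "U n"] field_simps)
    then have "h * ?a (V n) (V n) = (e n + 2 * (h * ?a (U n) (U (n - 1))) + e (n - 1)) / 4"
      by (simp add: e_def algebra_simps)
    moreover have "h * ?a (U n) (U (n - 1)) \<le> (e n + e (n - 1)) / 2"
      using half[OF Ubd Ubd, THEN abs_le_D1] n by (simp add: e_def)
    ultimately have "h * ?a (V n) (V n) \<le> (e n + e (n - 1)) / 2" by simp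
    also have "\<dots> \<le> e n + e (n - 1)" using e0[of n] e0[of "n - 1", OF le_trans[OF diff_le_self]] n by simp
    finally show ?thesis .
  qed
  have diag: "(e n - e (n - 1)) / 2 \<le> p n n - p (n - 1) n" if n: "1 \<le> n" "n \<le> N" for n
  proof (cases "n = 1")
    case True
    have "\<bar>h * ?a (U 0) (U 1)\<bar> \<le> (e 0 + e 1) / 2" using half[OF Ubd Ubd, of 0 1] N by (simp add: e_def)
    then show ?thesis using True by (simp add: p_def V_def test_function_def e_def)
  next
    case False
    then show ?thesis
      by (simp add: p_def V_def test_function_def avg_form_mean e_def avg_form_commute[of _ _ "U (n - Suc 0)" "U n"]
          field_simps)
  qed
  have pb: "\<bar>p k n\<bar> \<le> (e k + (e n + e (n - 1))) / 2" if "1 \<le> n" "k < n" "n \<le> N" for k n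
  proof -
    have "\<bar>p k n\<bar> \<le> (e k + h * ?a (V n) (V n)) / 2"
      using half[OF Ubd Vbd, of k n] that by (simp add: p_def e_def)
    also have "\<dots> \<le> (e k + (e n + e (n - 1))) / 2"
      using Ve[of n] that by simp
    finally show ?thesis .
  qed
  have balance: "c0_coeff \<tau> ?g * (p n n - p (n - 1) n)
        + (\<Sum>k=1..n-1. w_avg \<tau> ?g (n - k) * (p k n - p (k - 1) n)) + \<tau> * P n = \<tau> * R n"
    if n: "1 \<le> n" "n \<le> N" for n
  proof -
    have dt: "?m (?A (tdiff \<tau> U k)) (V n) = 1 / \<tau> * (?a (U k) (V n) - ?a (U (k - 1)) (V n))" for k
    proof -
      have "?m (?A (tdiff \<tau> U k)) (V n) = ?m (\<lambda>i j. 1 / \<tau> * (?A (U k) i j - ?A (U (k - 1)) i j)) (V n)"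
        by (rule mass_form_cong) (simp add: avg_tdiff)
      then show ?thesis by (simp only: mass_form_linear mass_form_avg[OF Vbd[OF n]])
    qed
    have "?m (\<lambda>i j. (c0_coeff \<tau> ?g * ?A (tdiff \<tau> U n) i j
        + (\<Sum>k=1..n-1. w_avg \<tau> ?g (n - k) * ?A (tdiff \<tau> U k) i j))
        - (\<Sum>k=1..n. quad_wt a \<tau> n k * ?L (V k) i j)) (V n)
      = ?m (\<lambda>i j. (\<Sum>k=1..n. source_wt a \<tau> n k * ?A (?F k) i j) + ?A (?b n) i j) (V n)"
      by (rule mass_form_cong) (use scheme[OF n] in \<open>simp add: mult.commute\<close>)
    then have eq: "c0_coeff \<tau> ?g * (1 / \<tau> * (?a (U n) (V n) - ?a (U (n - 1)) (V n)))
        + (\<Sum>k=1..n-1. w_avg \<tau> ?g (n - k) * (1 / \<tau> * (?a (U k) (V n) - ?a (U (k - 1)) (V n))))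
        - (\<Sum>k=1..n. quad_wt a \<tau> n k * ?m (?L (V k)) (V n))
      = (\<Sum>k=1..n. source_wt a \<tau> n k * ?m (?A (?F k)) (V n)) + ?m (?A (?b n)) (V n)"
      by (simp only: mass_form_linear dt)
    have t: "\<tau> * h * (x * (1 / \<tau> * (y - z))) = x * (h * y - h * z)" for x y z
      using \<tau> by (simp add: field_simps)
    have "\<tau> * R n = \<tau> * h * ((\<Sum>k=1..n. source_wt a \<tau> n k * ?m (?A (?F k)) (V n)) + ?m (?A (?b n)) (V n))"
      by (simp add: R_def distrib_left sum_distrib_left mult_ac)
    also have "\<dots> = c0_coeff \<tau> ?g * (h * ?a (U n) (V n) - h * ?a (U (n - 1)) (V n))
        + (\<Sum>k=1..n-1. w_avg \<tau> ?g (n - k) * (h * ?a (U k) (V n) - h * ?a (U (k - 1)) (V n)))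
        - \<tau> * h * (\<Sum>k=1..n. quad_wt a \<tau> n k * ?m (?L (V k)) (V n))"
      unfolding eq[symmetric] right_diff_distrib[of "\<tau> * h"] distrib_left[of "\<tau> * h"]
        sum_distrib_left[of "\<tau> * h" _ "{1..n-1}"] t ..
    finally show ?thesis by (simp add: p_def P_def sum_negf mult_ac)
  qed
  have P: "0 \<le> (\<Sum>n=1..k. P n)" if "k \<le> N" for k
  proof -
    have "0 \<le> (\<Sum>n=1..k. \<Sum>j=1..n. quad_wt a \<tau> n j * - ?m (?L (V j)) (V n))"
      by (rule compact_laplace_psd)
         (use quad_wt_psd[OF a(1,2) \<tau>(1)] Vbd that in \<open>auto simp: psd_pairing_def\<close>)
    then show ?thesis using h unfolding P_def sum_distrib_right[symmetric] by simp
  qed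
  have Rb: "R n \<le> source_const T a Qg Qf * (B + D)"
    if n: "1 \<le> n" "n \<le> N" and B: "\<And>k. k \<le> n \<Longrightarrow> e k \<le> B" for n B
  proof -
    have B0: "0 \<le> B" using B[of 0] e0[of 0] by simp
    have aV: "h * ?a (V n) (V n) \<le> 2 * B" using Ve[OF n] B[of n] B[of "n - 1"] by simp
    have "h * ?m (V n) (V n) \<le> h * (3 * ?a (V n) (V n))"
      using avg_form_ge[OF Vbd[OF n]] h by (intro mult_left_mono) auto
    with aV have mV: "h * ?m (V n) (V n) \<le> 6 * B" by simp
    have test: "h * ?m (?A v) (V n) \<le> (h * ?m v v + 6 * B) / 2" if "vanishes_on_boundary Mx My v" for v
    proof -
      have "h * ?m (?A v) (V n) \<le> (h * ?a v v + h * ?a (V n) (V n)) / 2"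
        using half[OF that Vbd[OF n]] by (simp add: mass_form_avg[OF Vbd[OF n]])
      moreover have "h * ?a v v \<le> h * ?m v v" using avg_form_le[OF that] h by simp
      ultimately show ?thesis using aV B0 by simp
    qed
    have lip: "\<bar>f x - f 0\<bar> \<le> Qf * \<bar>x\<bar>" for x by (rule C2_bounded_deriv_lipschitz[OF f])
    have lip2: "(f x - f 0)\<^sup>2 \<le> (Qf * x)\<^sup>2" for x
      using lip[of x] power_mono[of "\<bar>f x - f 0\<bar>" "Qf * \<bar>x\<bar>" 2] by (simp add: power_mult_distrib)
    \<comment> \<open>\<open>\<bar>f 0\<bar> \<le> \<bar>f (u0)\<bar> + Qf * \<bar>u0\<bar>\<close> at every interior node, so the norm of the constant \<open>f 0\<close> is
      controlled by the data even though the data are measured on interior nodes only.\<close>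
    have const: "h * ?m (\<lambda>i j. f 0) (\<lambda>i j. f 0) \<le> (2 + 2 * Qf\<^sup>2) * D"
    proof -
      have "f 0 * f 0 \<le> 2 * (f x * f x) + 2 * Qf\<^sup>2 * (x * x)" for x
        using lip2[of x] zero_le_power2[of "2 * f x - f 0"]
        by (simp add: power2_eq_square algebra_simps)
      then have "?m (\<lambda>i j. f 0) (\<lambda>i j. f 0)
         \<le> 2 * ?m (?E (f \<circ> u0)) (?E (f \<circ> u0)) + 2 * Qf\<^sup>2 * ?m (?E u0) (?E u0)"
        unfolding mass_form_def sum_distrib_left sum.distrib[symmetric]
        unfolding grid_eval_def o_def by (intro sum_mono)
      then have "h * ?m (\<lambda>i j. f 0) (\<lambda>i j. f 0)
         \<le> h * (2 * ?m (?E (f \<circ> u0)) (?E (f \<circ> u0)) + 2 * Qf\<^sup>2 * ?m (?E u0) (?E u0))"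
        using h by (intro mult_left_mono) auto
      also have "\<dots> = 2 * (h * ?m (?E (f \<circ> u0)) (?E (f \<circ> u0))) + 2 * Qf\<^sup>2 * (h * ?m (?E u0) (?E u0))"
        by (simp add: algebra_simps)
      also have "\<dots> \<le> 2 * D + 2 * Qf\<^sup>2 * D"
        using hm[of "?E ubar0"] hm[of "?E u0"] D(3)
        by (intro add_mono mult_left_mono) (auto simp: D_def)
      finally show ?thesis by (simp add: algebra_simps)
    qed
    have Fk: "h * ?m (?A (?F k)) (V n) \<le> (7 + 3 * Qf\<^sup>2) * (B + D)" if k: "k \<in> {1..n}" for k
    proof -
      let ?G = "\<lambda>i j. f (U k i j) - f 0"
      have kN: "k \<le> N" "k \<le> n" using k n by auto
      have "?m (?A (?F k)) (V n) = ?m (\<lambda>i j. f 0 + ?A ?G i j) (V n)"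
        by (rule mass_form_cong) (rule avg_shift_const)
      then have "h * ?m (?A (?F k)) (V n) = h * ?m (\<lambda>i j. f 0) (V n) + h * ?m (?A ?G) (V n)"
        by (simp only: mass_form_linear distrib_left)
      also have "h * ?m (\<lambda>i j. f 0) (V n) \<le> (h * ?m (\<lambda>i j. f 0) (\<lambda>i j. f 0) + h * ?m (V n) (V n)) / 2"
        using mult_left_mono[OF order.trans[OF abs_ge_self mass_form_abs_le], of h] h
        by (simp add: distrib_left)
      also have "\<dots> \<le> ((2 + 2 * Qf\<^sup>2) * D + 6 * B) / 2" using const mV by simp
      also have "h * ?m (?A ?G) (V n) \<le> (h * ?m ?G ?G + 6 * B) / 2"
        by (rule test) (use Ubd[OF kN(1)] in \<open>auto simp: vanishes_on_boundary_def\<close>)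
      also have "h * ?m ?G ?G \<le> h * ?m (\<lambda>i j. Qf * U k i j) (\<lambda>i j. Qf * U k i j)"
        using mass_form_mono[of Mx My ?G] lip2 h by (intro mult_left_mono) auto
      also have "\<dots> = Qf\<^sup>2 * (h * ?m (U k) (U k))"
        by (simp add: mass_form_def sum_distrib_left power2_eq_square mult_ac)
      also have "\<dots> \<le> Qf\<^sup>2 * (3 * B)" using Ue[OF kN(1)] B[OF kN(2)] by (intro mult_left_mono) auto
      finally have "h * ?m (?A (?F k)) (V n)
          \<le> ((2 + 2 * Qf\<^sup>2) * D + 6 * B) / 2 + (Qf\<^sup>2 * (3 * B) + 6 * B) / 2" by simp
      also have "\<dots> = (1 + Qf\<^sup>2) * D + (6 + 3 / 2 * Qf\<^sup>2) * B" by (simp add: field_simps)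
      also have "\<dots> \<le> (7 + 3 * Qf\<^sup>2) * D + (7 + 3 * Qf\<^sup>2) * B"
        using D(1) B0 by (intro add_mono mult_right_mono) auto
      finally show ?thesis by (simp add: algebra_simps)
    qed
    obtain c where c: "\<bar>c\<bar> \<le> Qg" "?b n = (\<lambda>i j. c * ?E ubar0 i j)"
      by (rule b_term_eq[OF g \<tau> n])
    have bn: "h * ?m (?A (?b n)) (V n) \<le> (Qg\<^sup>2 + 3) * (B + D)"
    proof -
      have c2: "c\<^sup>2 \<le> Qg\<^sup>2" using c(1) power_mono[of "\<bar>c\<bar>" Qg 2] by simp
      have "h * ?m (?A (?b n)) (V n)
          \<le> (h * ?m (\<lambda>i j. c * ?E ubar0 i j) (\<lambda>i j. c * ?E ubar0 i j) + 6 * B) / 2"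
        unfolding c(2) by (rule test[OF bbd])
      also have "h * ?m (\<lambda>i j. c * ?E ubar0 i j) (\<lambda>i j. c * ?E ubar0 i j) = c\<^sup>2 * (h * ?m (?E ubar0) (?E ubar0))"
        by (simp add: mass_form_def sum_distrib_left power2_eq_square mult_ac)
      also have "\<dots> \<le> Qg\<^sup>2 * D" using c2 D hm by (intro mult_mono) auto
      finally have "h * ?m (?A (?b n)) (V n) \<le> (Qg\<^sup>2 / 2) * D + 3 * B" by simp
      also have "\<dots> \<le> (Qg\<^sup>2 + 3) * D + (Qg\<^sup>2 + 3) * B"
        using D(1) B0 by (intro add_mono mult_right_mono) auto
      finally show ?thesis by (simp add: algebra_simps)
    qed
    have \<tau>n: "\<tau> * real n \<le> T" using tnode_le[OF \<tau> n(2)] by (simp add: tnode_def mult.commute)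
    have "(\<Sum>k=1..n. source_wt a \<tau> n k * (h * ?m (?A (?F k)) (V n)))
        \<le> (\<Sum>k=1..n. source_wt a \<tau> n k * ((7 + 3 * Qf\<^sup>2) * (B + D)))"
      by (intro sum_mono mult_left_mono Fk source_wt_nonneg[OF a(1,2) \<tau>(1) n(1) \<tau>n])
    also have "\<dots> = (\<Sum>k=1..n. source_wt a \<tau> n k) * ((7 + 3 * Qf\<^sup>2) * (B + D))"
      by (simp only: sum_distrib_right)
    also have "\<dots> \<le> 2 * (T powr a / Gamma (1 + a)) * ((7 + 3 * Qf\<^sup>2) * (B + D))"
      using B0 D(1) by (intro mult_right_mono source_wt_sum[OF a(1,2) \<tau>(1) n(1) \<tau>n]) auto
    finally have "R n \<le> 2 * (T powr a / Gamma (1 + a)) * ((7 + 3 * Qf\<^sup>2) * (B + D)) + (Qg\<^sup>2 + 3) * (B + D)"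
      unfolding R_def using bn by (rule add_mono)
    also have "\<dots> = source_const T a Qg Qf * (B + D)"
      by (simp only: source_const_def distrib_right mult.assoc)
    finally show ?thesis .
  qed
  have "e 0 \<le> D"
  proof -
    have "?m (U 0) (U 0) \<le> ?m (?E u0) (?E u0)" by (rule mass_form_mono) (simp add: U0)
    then have "h * ?m (U 0) (U 0) \<le> h * ?m (?E u0) (?E u0)" using h by simp
    also note D(3)
    finally have "h * ?m (U 0) (U 0) \<le> D" .
    moreover have "e 0 \<le> h * ?m (U 0) (U 0)" using avg_form_le[OF Ubd, of 0] h by (simp add: e_def)
    ultimately show ?thesis by simp
  qed
  have "e m \<le> (e 0 + D) * exp (2 * T * growth_const T a Qg Qf)"
  proof (rule memory_energy_bound[OF g T \<tau> growth_const_def small _ D(1) e0 diag pb balance P Rb m])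
    show "0 \<le> source_const T a Qg Qf"
      using a by (simp add: source_const_def)
  qed
  also have "\<dots> \<le> (2 * D) * exp (2 * T * growth_const T a Qg Qf)"
    using \<open>e 0 \<le> D\<close> by (intro mult_right_mono) auto
  finally have "e m \<le> (2 * D) * exp (2 * T * growth_const T a Qg Qf)" .
  then have "h * ?m (U m) (U m) \<le> 3 * ((2 * D) * exp (2 * T * growth_const T a Qg Qf))"
    using Ue[OF m] by simp
  also have "\<dots> = 6 * exp (2 * T * growth_const T a Qg Qf) * D" by simp
  finally show ?thesis unfolding norm2 D_def[symmetric] .
qed

theorem theorem4p1:
  fixes T abar Q\<^sub>g Q\<^sub>f :: real
  assumes "T > 0" and "0 < abar" and "abar < 1"
  shows "\<exists>Q>0. \<exists>\<tau>0>0.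
    \<forall>(lx::real) rx ly ry (\<alpha>::real \<Rightarrow> real) Q\<^sub>\<alpha> (f::real \<Rightarrow> real)
      (u0::real \<times> real \<Rightarrow> real) (ubar0::real \<times> real \<Rightarrow> real)
      (Mx::nat) (My::nat) (N::nat) (U::nat \<Rightarrow> gridfun).
      lx < rx \<longrightarrow> ly < ry \<longrightarrow>
      variable_order T Q\<^sub>\<alpha> \<alpha> \<longrightarrow> \<alpha> 0 - 1 = abar \<longrightarrow>
      g_bounds T Q\<^sub>g (g_fun \<alpha>) \<longrightarrow>
      C2_bounded_deriv Q\<^sub>f f \<longrightarrow>
      (\<forall>p\<in>frontier (rect lx rx ly ry). u0 p = 0 \<and> ubar0 p = 0) \<longrightarrow>
      Mx \<ge> 1 \<longrightarrow> My \<ge> 1 \<longrightarrow> N \<ge> 1 \<longrightarrow> T / real N \<le> \<tau>0 \<longrightarrow>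
      scheme_solution lx rx ly ry T \<alpha> f u0 ubar0 Mx My N U \<longrightarrow>
      (\<forall>n\<in>{1..N}.
         grid_norm (mesh_size lx rx Mx) (mesh_size ly ry My) Mx My (U n)
         \<le> Q * (grid_norm (mesh_size lx rx Mx) (mesh_size ly ry My) Mx My
                  (grid_eval lx rx ly ry Mx My u0)
              + grid_norm (mesh_size lx rx Mx) (mesh_size ly ry My) Mx My
                  (grid_eval lx rx ly ry Mx My (f \<circ> u0))
              + grid_norm (mesh_size lx rx Mx) (mesh_size ly ry My) Mx My
                  (grid_eval lx rx ly ry Mx My ubar0)))"
proof -
  define \<kappa> where "\<kappa> = growth_const T abar Q\<^sub>g Q\<^sub>f"
  define Q where "Q = sqrt (6 * exp (2 * T * \<kappa>))"
  define \<tau>0 where "\<tau>0 = min (1 / (2 * (\<bar>\<kappa>\<bar> + 1))) (1 / (\<bar>Q\<^sub>g\<bar> + 1))"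
  have Q: "0 < Q" by (simp add: Q_def)
  have \<tau>0: "0 < \<tau>0" by (simp add: \<tau>0_def add_nonneg_pos)
  have small: "\<tau> * \<kappa> \<le> 1 / 2" "Q\<^sub>g * \<tau> \<le> 1" if "0 < \<tau>" "\<tau> \<le> \<tau>0" for \<tau>
  proof -
    have "\<tau> * (2 * (\<bar>\<kappa>\<bar> + 1)) \<le> 1" "\<tau> * (\<bar>Q\<^sub>g\<bar> + 1) \<le> 1"
      using that(2) by (auto simp: \<tau>0_def pos_le_divide_eq add_nonneg_pos)
    moreover have "\<tau> * \<kappa> \<le> \<tau> * (\<bar>\<kappa>\<bar> + 1)" "\<tau> * Q\<^sub>g \<le> \<tau> * (\<bar>Q\<^sub>g\<bar> + 1)"
      using that(1) by auto
    ultimately show "\<tau> * \<kappa> \<le> 1 / 2" "Q\<^sub>g * \<tau> \<le> 1" by (simp_all add: algebra_simps)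
  qed
  have sq: "x \<le> Q * (a + b + c)"
    if "x\<^sup>2 \<le> 6 * exp (2 * T * \<kappa>) * (a\<^sup>2 + b\<^sup>2 + c\<^sup>2)" "0 \<le> a" "0 \<le> b" "0 \<le> c" for x a b c :: real
  proof (rule power2_le_imp_le)
    have "a\<^sup>2 + b\<^sup>2 + c\<^sup>2 \<le> (a + b + c)\<^sup>2"
      using that(2-) by (simp add: power2_eq_square algebra_simps)
    then have "6 * exp (2 * T * \<kappa>) * (a\<^sup>2 + b\<^sup>2 + c\<^sup>2) \<le> Q\<^sup>2 * (a + b + c)\<^sup>2"
      by (simp add: Q_def)
    with that(1) show "x\<^sup>2 \<le> (Q * (a + b + c))\<^sup>2" by (simp add: power_mult_distrib)
  qed (use Q that in simp)
  have gn: "0 \<le> grid_norm (mesh_size lx rx Mx) (mesh_size ly ry My) Mx My v"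
    if "lx < rx" "ly < ry" for lx rx ly ry Mx My v
    unfolding grid_norm_def
    by (intro real_sqrt_ge_zero mult_nonneg_nonneg sum_nonneg) (use that in \<open>auto simp: mesh_size_def\<close>)
  show ?thesis
  proof (rule exI[of _ Q], rule conjI[OF Q], rule exI[of _ \<tau>0], rule conjI[OF \<tau>0], intro allI impI ballI)
    fix lx rx ly ry :: real and \<alpha> Q\<^sub>\<alpha> f u0 ubar0 Mx My N and U :: "nat \<Rightarrow> gridfun" and n
    assume "lx < rx" "ly < ry" "\<alpha> 0 - 1 = abar" "g_bounds T Q\<^sub>g (g_fun \<alpha>)" "C2_bounded_deriv Q\<^sub>f f"
      "\<forall>p\<in>frontier (rect lx rx ly ry). u0 p = 0 \<and> ubar0 p = 0" "1 \<le> Mx" "1 \<le> My" "1 \<le> N"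
      "T / real N \<le> \<tau>0" "scheme_solution lx rx ly ry T \<alpha> f u0 ubar0 Mx My N U" "n \<in> {1..N}"
    then show "grid_norm (mesh_size lx rx Mx) (mesh_size ly ry My) Mx My (U n)
         \<le> Q * (grid_norm (mesh_size lx rx Mx) (mesh_size ly ry My) Mx My
                  (grid_eval lx rx ly ry Mx My u0)
              + grid_norm (mesh_size lx rx Mx) (mesh_size ly ry My) Mx My
                  (grid_eval lx rx ly ry Mx My (f \<circ> u0))
              + grid_norm (mesh_size lx rx Mx) (mesh_size ly ry My) Mx My
                  (grid_eval lx rx ly ry Mx My ubar0))"
      using assms small[of "T / real N"]
      by (intro sq gn scheme_stability[of T abar \<alpha> lx rx ly ry Mx My N Q\<^sub>g Q\<^sub>f f u0 ubar0 U n, folded \<kappa>_def])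
         auto
  qed
qed

end
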